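(* Let $\alpha,\beta>0$ be such that $0<2\beta<\alpha$, and let $f:\mathbb{Z}\to\mathbb{R}$. (i) If $f\in\Lambda_H^\alpha\cap\ell_\beta$, then $(-\Delta_d)^\beta f\in\Lambda_H^{\alpha-2\beta}$, where $(-\Delta_d)^\beta$ is defined by $$(-\Delta_d)^\beta f(n)=\frac{1}{c_\beta}\int_0^\infty\left(e^{\tau\Delta_d}-I\right)^{[\beta]+1}f(n)\frac{d\tau}{\tau^{1+\beta}},\quad n\in\mathbb{Z},\qquad c_\beta=\int_0^\infty(e^{-\tau}-1)^{[\beta]+1}\frac{d\tau}{\tau^{1+\beta}}.$$ (ii) If $f\in\Lambda_H^\alpha$ and $\beta\in\mathbb{N}$, then $(-\Delta_d)^\beta f$, understood as the $\beta$-fold iteration of $-\Delta_d$ applied to $f$, belongs to $\Lambda_H^{\alpha-2\beta}$.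
   Context: Heat semigroup: $I_n(t)=\sum_{m=0}^\infty\frac{1}{m!\,\Gamma(m+n+1)}(t/2)^{2m+n}$ for $n\in\mathbb{N}_0$, $I_{-n}=I_n$; $G(t,n)=e^{-2t}I_n(2t)$ for $t>0$, $n\in\mathbb{Z}$; $e^{t\Delta_d}f(n)=\sum_{j\in\mathbb{Z}}G(t,n-j)f(j)$, where $\Delta_df(n)=f(n+1)-2f(n)+f(n-1)$. $I$ without index denotes the identity operator, and $[\cdot]$ the integer part. For $\alpha>0$, $\Lambda_H^\alpha$ is the set of $f:\mathbb{Z}\to\mathbb{R}$ with $\frac{f}{1+|\cdot|^\alpha}\in\ell^\infty(\mathbb{Z})$ for which there is $C_\alpha>0$ with $\|\partial_t^ke^{t\Delta_d}f\|_\infty\le C_\alpha t^{-k+\alpha/2}$ for all $t>0$, where $k=[\alpha/2]+1$ and $\|\cdot\|_\infty$ is the supremum norm over $\mathbb{Z}$. For $\beta>0$, $\ell_\beta=\{u:\mathbb{Z}\to\mathbb{R}:\ \sum_{m\in\mathbb{Z}}\frac{|u(m)|}{(1+|m|)^{1+2\beta}}<\infty\}$. *)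

theory Defs
  imports "HOL-Analysis.Analysis"
begin

definition bessel_I :: "int \<Rightarrow> real \<Rightarrow> real" where
  "bessel_I n t =
     (\<Sum>m. 1 / (fact m * Gamma (real (m + nat \<bar>n\<bar> + 1))) * (t / 2) ^ (2 * m + nat \<bar>n\<bar>))"

definition heat_kernel :: "real \<Rightarrow> int \<Rightarrow> real" where
  "heat_kernel t n = exp (- 2 * t) * bessel_I n (2 * t)"

(* Meaningful for t > 0.  If f has polynomial growth the series converges absolutely. *)
definition heat_semigroup :: "real \<Rightarrow> (int \<Rightarrow> real) \<Rightarrow> int \<Rightarrow> real" where
  "heat_semigroup t f n = (\<Sum>\<^sub>\<infinity>j. heat_kernel t (n - j) * f j)"

definition discrete_laplacian :: "(int \<Rightarrow> real) \<Rightarrow> int \<Rightarrow> real" where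
  "discrete_laplacian f n = f (n + 1) - 2 * f n + f (n - 1)"

(* Since deriv is total, the existence of the time derivatives up to order k is stated
   explicitly.  The bound on the supremum norm over the integers is stated pointwise, which
   also expresses that the supremum is finite. *)
definition Lambda_H :: "real \<Rightarrow> (int \<Rightarrow> real) set" where
  "Lambda_H \<alpha> = {f.
     bounded (range (\<lambda>n. f n / (1 + \<bar>real_of_int n\<bar> powr \<alpha>))) \<and>
     (let k = nat \<lfloor>\<alpha> / 2\<rfloor> + 1 in
        (\<forall>n. \<forall>t>0. \<forall>i<k. (deriv ^^ i) (\<lambda>s. heat_semigroup s f n) differentiable (at t)) \<and>
        (\<exists>C>0. \<forall>t>0. \<forall>n.
           \<bar>(deriv ^^ k) (\<lambda>s. heat_semigroup s f n) t\<bar> \<le> C * t powr (- real k + \<alpha> / 2)))}"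

definition ell_space :: "real \<Rightarrow> (int \<Rightarrow> real) set" where
  "ell_space \<beta> = {u. (\<lambda>m. \<bar>u m\<bar> / (1 + \<bar>real_of_int m\<bar>) powr (1 + 2 * \<beta>)) summable_on UNIV}"

definition heat_difference :: "real \<Rightarrow> (int \<Rightarrow> real) \<Rightarrow> int \<Rightarrow> real" where
  "heat_difference \<tau> f n = heat_semigroup \<tau> f n - f n"

definition frac_integrand :: "real \<Rightarrow> (int \<Rightarrow> real) \<Rightarrow> int \<Rightarrow> real \<Rightarrow> real" where
  "frac_integrand \<beta> f n \<tau> = (heat_difference \<tau> ^^ (nat \<lfloor>\<beta>\<rfloor> + 1)) f n / \<tau> powr (1 + \<beta>)"

definition frac_const :: "real \<Rightarrow> real" where
  "frac_const \<beta> = (LBINT \<tau>:{0<..}. (exp (- \<tau>) - 1) ^ (nat \<lfloor>\<beta>\<rfloor> + 1) / \<tau> powr (1 + \<beta>))"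

(* The Lebesgue integral is 0 when frac_integrand is not integrable, so convergence has to be
   stated separately. *)
definition frac_laplacian :: "real \<Rightarrow> (int \<Rightarrow> real) \<Rightarrow> int \<Rightarrow> real" where
  "frac_laplacian \<beta> f n = 1 / frac_const \<beta> * (LBINT \<tau>:{0<..}. frac_integrand \<beta> f n \<tau>)"

end

theory Submission
  imports Defs
begin

text \<open>
  The discrete heat semigroup is a product of two commuting Poisson semigroups: the time-changed
  walk jumps to the right and to the left at the times of two independent Poisson processes, so
  \<open>T\<^sub>t f(n)\<close> is the mean of \<open>f (n + a - b)\<close> for independent Poisson variables \<open>a\<close>, \<open>b\<close> of mean \<open>t\<close>
  (\<open>heat_semigroup_has_sum\<close>).  On sequences of at most exponential growth this double sum converges
  absolutely.  Summing it along antidiagonals gives a power series in \<open>t\<close>, hence the heat equation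
  (\<open>heat_equation\<close>), the semigroup law (\<open>heat_semigroup_semigroup\<close>) and the fact that time
  derivatives are Laplacians.  Thus \<open>f \<in> Lambda_H \<alpha>\<close> says that \<open>f\<close> has polynomial growth of order
  \<open>\<alpha>\<close> and that \<open>|T\<^sub>t \<Delta>\<^sup>k f| \<le> C t powr (\<alpha>/2 - k)\<close> for the least \<open>k > \<alpha>/2\<close> (\<open>Lambda_H_iff\<close>).

  All smoothing estimates follow from one inequality, \<open>|\<nabla> T\<^sub>t f(n)|\<^sup>2 \<le> T\<^sub>t(f\<^sup>2)(n) / t\<close>
  (\<open>heat_gradient_estimate\<close>).  A Poisson weight satisfies \<open>p (a - 1) - p a = p a * (a/t - 1)\<close>, so a
  difference quotient of \<open>T\<^sub>t f\<close> is a covariance of \<open>f\<close> with \<open>a/t - 1\<close>, whose variance is \<open>1/t\<close>, and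
  the inequality is Cauchy-Schwarz.  As the right-hand side is again a heat average it can be
  iterated and used with growing data: exponentials are eigenfunctions, so for \<open>f\<close> of growth \<open>\<alpha>\<close> and
  \<open>t \<ge> max 1 n\<^sup>2\<close> one gets \<open>|T\<^sub>t \<Delta>\<^sup>j f(n)| \<le> C t powr (\<alpha>/2 - j)\<close> (\<open>heat_laplacian_poly_growth\<close>).
  Applied to the indicator of a half-line it bounds the heat kernel itself
  (\<open>heat_kernel_exponential_bound\<close>).

  Fix \<open>n\<close> and put \<open>R = 1 + n\<^sup>2\<close>.  Starting from the estimates at time \<open>R\<close> and integrating the heat
  equation backwards controls \<open>T\<^sub>s \<Delta>\<^sup>j f(n)\<close> for all \<open>s \<le> R\<close>
  (\<open>Lambda_H_heat_laplacian_bound_local\<close>).  For \<open>j < \<alpha>/2\<close> one may go down to \<open>s = 0\<close> and finds that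
  \<open>\<Delta>\<^sup>j f\<close> has growth \<open>\<alpha> - 2 j\<close>; this settles the integer case (\<open>Lambda_H_iterated_laplacian\<close>).

  In the fractional case the integrand is a \<open>K\<close>-fold time difference of \<open>s \<mapsto> T\<^sub>s f(n)\<close> with
  \<open>K = [\<beta>] + 1 > \<beta>\<close>.  Such a difference is of size \<open>\<tau> powr \<gamma>\<close> if the \<open>K\<close>-th derivative is of size
  \<open>s powr (\<gamma> - K)\<close> (\<open>iterated_step_difference_bound\<close>).  For \<open>\<tau> \<le> R\<close> this applies with some
  \<open>\<gamma> > \<beta>\<close>.  For \<open>\<tau> \<ge> R\<close> the kernel bound gives a kernel whose time integral against
  \<open>\<tau> powr (- 1 - \<beta>)\<close> is at most a multiple of \<open>(1 + |m|) powr (- 1 - 2 \<beta>)\<close>, uniformly in \<open>n\<close>, which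
  is the weight of \<open>ell_space \<beta>\<close> (\<open>heat_tail_integral\<close>).  So the integral converges and has growth
  \<open>\<alpha> - 2 \<beta>\<close> (\<open>frac_integrand_local_bound\<close>), and Fubini moves \<open>T\<^sub>t \<Delta>\<^sup>k\<close> inside.  There the difference
  lemma is used with an exponent above \<open>\<beta>\<close> for \<open>\<tau> \<le> t\<close> and with one below \<open>\<beta>\<close> for \<open>\<tau> \<ge> t\<close>
  (\<open>Lambda_H_frac_laplacian\<close>).
\<close>

section \<open>Sequences of exponential growth\<close>

definition exp_growth :: "(int \<Rightarrow> real) \<Rightarrow> bool" where
  "exp_growth f \<longleftrightarrow> (\<exists>C c. \<forall>n. \<bar>f n\<bar> \<le> C * exp (c * \<bar>real_of_int n\<bar>))"

section \<open>The heat semigroup as a two-sided Poisson average\<close>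

text \<open>
  For \<open>t \<ge> 0\<close>, the joint law of two independent Poisson variables of mean \<open>t\<close>.  It makes sense for
  every real \<open>t\<close>, which is convenient for differentiating at \<open>t = 0\<close>.
\<close>

definition jump_weight :: "real \<Rightarrow> nat \<times> nat \<Rightarrow> real" where
  "jump_weight t p = exp (- 2 * t) * (t ^ fst p / fact (fst p)) * (t ^ snd p / fact (snd p))"

definition endpoint :: "int \<Rightarrow> nat \<times> nat \<Rightarrow> int" where
  "endpoint n p = n + int (fst p) - int (snd p)"

lemma exp_growthE:
  assumes "exp_growth f"
  obtains C c where "C \<ge> 0" "c \<ge> 0" "\<And>n. \<bar>f n\<bar> \<le> C * exp (c * \<bar>real_of_int n\<bar>)"
proof -
  obtain C c where *: "\<And>n. \<bar>f n\<bar> \<le> C * exp (c * \<bar>real_of_int n\<bar>)"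
    using assms unfolding exp_growth_def by blast
  have C: "C \<ge> 0" using *[of 0] by auto
  have "\<bar>f n\<bar> \<le> C * exp (\<bar>c\<bar> * \<bar>real_of_int n\<bar>)" for n
    by (rule order_trans[OF *]) (intro mult_left_mono C, auto intro!: mult_right_mono)
  then show ?thesis using that[of C "\<bar>c\<bar>"] C by auto
qed

lemma exp_growthI: "(\<And>n. \<bar>f n\<bar> \<le> C * exp (c * \<bar>real_of_int n\<bar>)) \<Longrightarrow> exp_growth f"
  unfolding exp_growth_def by blast

lemma exp_growth_le:
  assumes "exp_growth g" "\<And>n. \<bar>f n\<bar> \<le> \<bar>g n\<bar>"
  shows "exp_growth f"
  using assms unfolding exp_growth_def by (meson order_trans)

lemma exp_growth_add [intro]:
  assumes "exp_growth f" "exp_growth g"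
  shows "exp_growth (\<lambda>n. f n + g n)"
proof -
  obtain C c where f: "C \<ge> 0" "c \<ge> 0" "\<And>n. \<bar>f n\<bar> \<le> C * exp (c * \<bar>real_of_int n\<bar>)"
    using exp_growthE[OF assms(1)] by blast
  obtain D d where g: "D \<ge> 0" "d \<ge> 0" "\<And>n. \<bar>g n\<bar> \<le> D * exp (d * \<bar>real_of_int n\<bar>)"
    using exp_growthE[OF assms(2)] by blast
  have "\<bar>f n + g n\<bar> \<le> (C + D) * exp ((c + d) * \<bar>real_of_int n\<bar>)" for n
  proof -
    have "C * exp (c * \<bar>real_of_int n\<bar>) \<le> C * exp ((c + d) * \<bar>real_of_int n\<bar>)"
      using f g by (intro mult_left_mono) (auto simp: algebra_simps)
    moreover have "D * exp (d * \<bar>real_of_int n\<bar>) \<le> D * exp ((c + d) * \<bar>real_of_int n\<bar>)"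
      using f g by (intro mult_left_mono) (auto simp: algebra_simps)
    ultimately show ?thesis using f(3)[of n] g(3)[of n] abs_triangle_ineq[of "f n" "g n"]
      unfolding distrib_right[of C D] by linarith
  qed
  then show ?thesis by (rule exp_growthI)
qed

lemma exp_growth_mult [intro]:
  assumes "exp_growth f" "exp_growth g"
  shows "exp_growth (\<lambda>n. f n * g n)"
proof -
  obtain C c where f: "C \<ge> 0" "c \<ge> 0" "\<And>n. \<bar>f n\<bar> \<le> C * exp (c * \<bar>real_of_int n\<bar>)"
    using exp_growthE[OF assms(1)] by blast
  obtain D d where g: "D \<ge> 0" "d \<ge> 0" "\<And>n. \<bar>g n\<bar> \<le> D * exp (d * \<bar>real_of_int n\<bar>)"
    using exp_growthE[OF assms(2)] by blast
  have "\<bar>f n * g n\<bar> \<le> (C * D) * exp ((c + d) * \<bar>real_of_int n\<bar>)" for n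
  proof -
    have "\<bar>f n * g n\<bar> \<le> (C * exp (c * \<bar>real_of_int n\<bar>)) * (D * exp (d * \<bar>real_of_int n\<bar>))"
      unfolding abs_mult using f g by (intro mult_mono) auto
    also have "\<dots> = (C * D) * exp ((c + d) * \<bar>real_of_int n\<bar>)"
      by (simp add: exp_add algebra_simps)
    finally show ?thesis .
  qed
  then show ?thesis by (rule exp_growthI)
qed

lemma exp_growth_const [intro, simp]: "exp_growth (\<lambda>n. c)"
  by (rule exp_growthI[of _ "\<bar>c\<bar>" 0]) auto

lemma exp_growth_exp [intro]: "exp_growth (\<lambda>n. exp (c * real_of_int n))"
  by (rule exp_growthI[of _ 1 "\<bar>c\<bar>"]) (auto simp flip: abs_mult)

lemma exp_growth_abs [intro]: "exp_growth f \<Longrightarrow> exp_growth (\<lambda>n. \<bar>f n\<bar>)"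
  by (erule exp_growth_le) auto

lemma exp_growth_uminus [intro]: "exp_growth f \<Longrightarrow> exp_growth (\<lambda>n. - f n)"
  by (erule exp_growth_le) auto

lemma exp_growth_diff [intro]:
  "exp_growth f \<Longrightarrow> exp_growth g \<Longrightarrow> exp_growth (\<lambda>n. f n - g n)"
  using exp_growth_add[of f "\<lambda>n. - g n"] by auto

lemma exp_growth_cmult [intro]: "exp_growth f \<Longrightarrow> exp_growth (\<lambda>n. c * f n)"
  by (rule exp_growth_mult) auto

lemma exp_growth_power [intro]: "exp_growth f \<Longrightarrow> exp_growth (\<lambda>n. f n ^ k)"
  by (induction k) auto

lemma exp_growth_shift [intro]:
  assumes "exp_growth f"
  shows "exp_growth (\<lambda>n. f (n + m))"
proof -
  obtain C c where f: "C \<ge> 0" "c \<ge> 0" "\<And>n. \<bar>f n\<bar> \<le> C * exp (c * \<bar>real_of_int n\<bar>)"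
    using exp_growthE[OF assms] by blast
  have "\<bar>f (n + m)\<bar> \<le> (C * exp (c * \<bar>real_of_int m\<bar>)) * exp (c * \<bar>real_of_int n\<bar>)" for n
  proof -
    have "\<bar>f (n + m)\<bar> \<le> C * exp (c * \<bar>real_of_int (n + m)\<bar>)" by (rule f)
    also have "\<dots> \<le> C * exp (c * (\<bar>real_of_int n\<bar> + \<bar>real_of_int m\<bar>))"
      using f by (intro mult_left_mono iffD2[OF exp_le_cancel_iff]) auto
    finally show ?thesis by (simp add: exp_add algebra_simps)
  qed
  then show ?thesis by (rule exp_growthI)
qed

lemma exp_growth_shift_minus [intro]: "exp_growth f \<Longrightarrow> exp_growth (\<lambda>n. f (n - m))"
  using exp_growth_shift[of f "- m"] by simp

lemma has_sum_exp_series: "((\<lambda>j. x ^ j / fact j) has_sum exp x) UNIV" for x :: real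
proof (rule norm_summable_imp_has_sum)
  show "summable (\<lambda>j. norm (x ^ j / fact j))"
    using summable_norm_exp[of x] by (simp add: field_simps)
  show "(\<lambda>j. x ^ j / fact j) sums exp x"
    using exp_converges[of x] by (simp add: field_simps)
qed

lemma summable_weighted_endpoint:
  assumes "exp_growth f"
  shows "(\<lambda>p. jump_weight t p * f (endpoint n p)) summable_on UNIV"
proof -
  obtain C c where f: "C \<ge> 0" "c \<ge> 0" "\<And>n. \<bar>f n\<bar> \<le> C * exp (c * \<bar>real_of_int n\<bar>)"
    using exp_growthE[OF assms] by blast
  define x where "x = \<bar>t\<bar> * exp c"
  define K where "K = exp (- 2 * t) * C * exp (c * \<bar>real_of_int n\<bar>)"
  have x: "x \<ge> 0" unfolding x_def by simp
  have "(\<lambda>p. (x ^ fst p / fact (fst p)) * (x ^ snd p / fact (snd p))) summable_on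
          (SIGMA a:(UNIV::nat set). (UNIV::nat set))"
  proof (rule summable_on_SigmaI)
    show "((\<lambda>b. x ^ fst (a, b) / fact (fst (a, b)) * (x ^ snd (a, b) / fact (snd (a, b))))
            has_sum (x ^ a / fact a * exp x)) UNIV" for a
      using has_sum_cmult_right[OF has_sum_exp_series, of "x ^ a / fact a" x] by simp
    show "(\<lambda>a. x ^ a / fact a * exp x) summable_on UNIV"
      using has_sum_cmult_left[OF has_sum_exp_series] has_sum_imp_summable by blast
  qed (use x in auto)
  then have "(\<lambda>p. (x ^ fst p / fact (fst p)) * (x ^ snd p / fact (snd p))) summable_on UNIV"
    by simp
  then have "(\<lambda>p. K * ((x ^ fst p / fact (fst p)) * (x ^ snd p / fact (snd p)))) summable_on UNIV"
    by (rule summable_on_cmult_right)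
  then have "(\<lambda>p. norm (jump_weight t p * f (endpoint n p))) summable_on UNIV"
  proof (rule Infinite_Sum.abs_summable_on_comparison_test')
    fix p :: "nat \<times> nat"
    obtain a b where p: "p = (a, b)" by force
    have "\<bar>f (endpoint n p)\<bar> \<le> C * exp (c * \<bar>real_of_int (endpoint n p)\<bar>)" by (rule f)
    also have "\<dots> \<le> C * exp (c * (\<bar>real_of_int n\<bar> + (real a + real b)))"
      using f by (intro mult_left_mono iffD2[OF exp_le_cancel_iff])
        (auto simp: endpoint_def p)
    also have "\<dots> = C * exp (c * \<bar>real_of_int n\<bar>) * (exp c ^ a * exp c ^ b)"
      by (simp add: algebra_simps flip: exp_of_nat_mult exp_add)
    finally have 1: "\<bar>f (endpoint n p)\<bar> \<le> C * exp (c * \<bar>real_of_int n\<bar>) * (exp c ^ a * exp c ^ b)" .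
    have "norm (jump_weight t p * f (endpoint n p))
        = exp (- 2 * t) * (\<bar>t\<bar> ^ a / fact a) * (\<bar>t\<bar> ^ b / fact b) * \<bar>f (endpoint n p)\<bar>"
      by (simp add: jump_weight_def p abs_mult power_abs)
    also have "\<dots> \<le> exp (- 2 * t) * (\<bar>t\<bar> ^ a / fact a) * (\<bar>t\<bar> ^ b / fact b)
        * (C * exp (c * \<bar>real_of_int n\<bar>) * (exp c ^ a * exp c ^ b))"
      by (intro mult_left_mono 1) auto
    also have "\<dots> = K * ((x ^ fst p / fact (fst p)) * (x ^ snd p / fact (snd p)))"
      by (simp add: K_def x_def p power_mult_distrib)
    finally show "norm (jump_weight t p * f (endpoint n p))
        \<le> K * ((x ^ fst p / fact (fst p)) * (x ^ snd p / fact (snd p)))" .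
  qed
  then show ?thesis using summable_on_iff_abs_summable_on_real by blast
qed

text \<open>
  The Bessel series collects the jump weights of all pairs with a fixed difference: such a pair is
  its minimal representative, which has a zero entry, plus a diagonal shift.
\<close>

lemma heat_kernel_series:
  assumes "((\<lambda>i. jump_weight t (i + p, i + q)) summable_on UNIV)" "min p q = 0"
  shows "((\<lambda>i. jump_weight t (i + p, i + q)) has_sum heat_kernel t (int q - int p)) UNIV"
proof -
  let ?n = "int q - int p"
  have summand: "exp (- 2 * t) * (1 / (fact i * Gamma (real (i + nat \<bar>?n\<bar> + 1))) * (2 * t / 2) ^ (2 * i + nat \<bar>?n\<bar>))
      = jump_weight t (i + p, i + q)" for i
  proof -
    have "Gamma (real (i + nat \<bar>?n\<bar> + 1)) = fact (i + nat \<bar>?n\<bar>)"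
      using Gamma_fact[of "i + nat \<bar>?n\<bar>", where 'a=real] by (simp add: add_ac)
    moreover have "(p = 0 \<and> nat \<bar>?n\<bar> = q) \<or> (q = 0 \<and> nat \<bar>?n\<bar> = p)"
      using assms(2) by (auto simp: min_def split: if_splits)
    ultimately show ?thesis
      by (auto simp: jump_weight_def power_add power_mult power2_eq_square power_mult_distrib field_simps)
  qed
  obtain S where S: "((\<lambda>i. jump_weight t (i + p, i + q)) has_sum S) UNIV"
    using assms(1) summable_on_def by blast
  have "(\<lambda>i. jump_weight t (i + p, i + q) * exp (2 * t)) sums (S * exp (2 * t))"
    by (intro sums_mult2 has_sum_imp_sums[OF S])
  moreover have "jump_weight t (i + p, i + q) * exp (2 * t) =
     1 / (fact i * Gamma (real (i + nat \<bar>?n\<bar> + 1))) * (2 * t / 2) ^ (2 * i + nat \<bar>?n\<bar>)" for i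
    unfolding summand[symmetric] by (simp add: exp_minus)
  ultimately have "(\<lambda>i. 1 / (fact i * Gamma (real (i + nat \<bar>?n\<bar> + 1))) * (2 * t / 2) ^ (2 * i + nat \<bar>?n\<bar>))
      sums (S * exp (2 * t))" by simp
  then have "bessel_I ?n (2 * t) = S * exp (2 * t)"
    unfolding bessel_I_def by (rule sums_unique[symmetric])
  then have "heat_kernel t ?n = S" by (simp add: heat_kernel_def exp_minus)
  with S show ?thesis by simp
qed

text \<open>
  A pair of jump counts is determined by the site that it leads to and by the number of cancelling
  jumps.  Summing first over the cancelling jumps turns the double sum into the convolution with the
  Bessel kernel.
\<close>

lemma
  assumes "exp_growth f"
  shows heat_semigroup_has_sum:
      "((\<lambda>p. jump_weight t p * f (endpoint n p)) has_sum heat_semigroup t f n) UNIV"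
    and heat_kernel_has_sum:
      "((\<lambda>j. heat_kernel t (n - j) * f j) has_sum heat_semigroup t f n) UNIV"
proof -
  let ?g = "\<lambda>p. jump_weight t p * f (endpoint n p)"
  let ?\<pi> = "\<lambda>(j, i). (i + nat (j - n), i + nat (n - j))"
  have jw: "(\<lambda>p. jump_weight t p) summable_on UNIV"
    using summable_weighted_endpoint[of "\<lambda>_. 1" t n] by auto
  have bij: "bij_betw ?\<pi> (UNIV :: (int \<times> nat) set) UNIV"
    by (rule bij_betwI[where g = "\<lambda>p. (endpoint n p, min (fst p) (snd p))"])
      (auto simp: endpoint_def)
  obtain S where S: "(?g has_sum S) UNIV"
    using summable_weighted_endpoint[OF assms] summable_on_def by blast
  have S': "((\<lambda>q. ?g (?\<pi> q)) has_sum S) (SIGMA j:UNIV. UNIV)"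
    using has_sum_reindex_bij_betw[OF bij, of ?g S] S by simp
  have inner: "((\<lambda>i. ?g (?\<pi> (j, i))) has_sum (heat_kernel t (n - j) * f j)) UNIV" for j
  proof -
    have inj: "inj (\<lambda>i. (i + nat (j - n), i + nat (n - j)))" by (auto simp: inj_on_def)
    have "(\<lambda>p. jump_weight t p) summable_on (range (\<lambda>i. (i + nat (j - n), i + nat (n - j))))"
      using jw by (rule summable_on_subset_banach) auto
    then have sm: "(\<lambda>i. jump_weight t (i + nat (j - n), i + nat (n - j))) summable_on UNIV"
      by (subst (asm) summable_on_reindex[OF inj]) (simp add: o_def)
    have "((\<lambda>i. jump_weight t (i + nat (j - n), i + nat (n - j))) has_sum heat_kernel t (int (nat (n - j)) - int (nat (j - n)))) UNIV"
      by (rule heat_kernel_series[OF sm]) auto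
    moreover have "int (nat (n - j)) - int (nat (j - n)) = n - j" by auto
    moreover have "endpoint n (i + nat (j - n), i + nat (n - j)) = j" for i
      by (auto simp: endpoint_def)
    ultimately show ?thesis by (auto intro: has_sum_cmult_left)
  qed
  have *: "((\<lambda>j. heat_kernel t (n - j) * f j) has_sum S) UNIV"
    by (rule has_sum_SigmaD[OF S']) (use inner in auto)
  then have "heat_semigroup t f n = S"
    unfolding heat_semigroup_def by (rule infsumI)
  with S * show "(?g has_sum heat_semigroup t f n) UNIV"
    and "((\<lambda>j. heat_kernel t (n - j) * f j) has_sum heat_semigroup t f n) UNIV" by simp_all
qed

lemma heat_semigroup_eqI:
  assumes "exp_growth f" "((\<lambda>p. jump_weight t p * f (endpoint n p)) has_sum x) UNIV"
  shows "heat_semigroup t f n = x"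
  using heat_semigroup_has_sum[OF assms(1)] assms(2) has_sum_unique by blast

lemma heat_semigroup_add:
  assumes "exp_growth f" "exp_growth g"
  shows "heat_semigroup t (\<lambda>n. f n + g n) n = heat_semigroup t f n + heat_semigroup t g n"
  using has_sum_add[OF heat_semigroup_has_sum[OF assms(1), of t n] heat_semigroup_has_sum[OF assms(2), of t n]]
  by (intro heat_semigroup_eqI exp_growth_add assms) (simp add: algebra_simps)

lemma heat_semigroup_cmult:
  assumes "exp_growth f"
  shows "heat_semigroup t (\<lambda>n. c * f n) n = c * heat_semigroup t f n"
  using has_sum_cmult_right[OF heat_semigroup_has_sum[OF assms(1), of t n], of c]
  by (intro heat_semigroup_eqI exp_growth_cmult assms) (simp add: algebra_simps)

lemma heat_semigroup_diff:
  assumes "exp_growth f" "exp_growth g"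
  shows "heat_semigroup t (\<lambda>n. f n - g n) n = heat_semigroup t f n - heat_semigroup t g n"
  using heat_semigroup_add[OF assms(1) exp_growth_cmult[OF assms(2), of "-1"], of t n]
    heat_semigroup_cmult[OF assms(2), of t "-1" n] by simp

lemma heat_semigroup_shift:
  assumes "exp_growth f"
  shows "heat_semigroup t (\<lambda>n. f (n + m)) n = heat_semigroup t f (n + m)"
  using heat_semigroup_has_sum[OF assms, of t "n + m"]
  by (intro heat_semigroup_eqI exp_growth_shift assms) (simp add: endpoint_def algebra_simps)

lemma jump_weight_nonneg: "t \<ge> 0 \<Longrightarrow> jump_weight t p \<ge> 0"
  by (simp add: jump_weight_def)

lemma heat_semigroup_mono:
  assumes "exp_growth f" "exp_growth g" "t \<ge> 0" "\<And>n. f n \<le> g n"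
  shows "heat_semigroup t f n \<le> heat_semigroup t g n"
  by (rule has_sum_mono[OF heat_semigroup_has_sum heat_semigroup_has_sum])
    (use assms in \<open>auto intro!: mult_left_mono jump_weight_nonneg\<close>)

lemma heat_semigroup_abs_le:
  assumes "exp_growth f" "t \<ge> 0"
  shows "\<bar>heat_semigroup t f n\<bar> \<le> heat_semigroup t (\<lambda>n. \<bar>f n\<bar>) n"
  using heat_semigroup_mono[of f "\<lambda>n. \<bar>f n\<bar>" t n] heat_semigroup_mono[of "\<lambda>n. - f n" "\<lambda>n. \<bar>f n\<bar>" t n]
    heat_semigroup_cmult[of f t "-1" n] assms
  by (simp add: exp_growth_abs exp_growth_uminus abs_le_iff abs_ge_minus_self)

section \<open>Power series, heat equation and semigroup law\<close>

text \<open>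
  The Laplacian plus twice the identity.  It has nonnegative coefficients, so its powers count walks
  and majorants are preserved.
\<close>

definition neighbour_sum :: "(int \<Rightarrow> real) \<Rightarrow> int \<Rightarrow> real" where
  "neighbour_sum f n = f (n + 1) + f (n - 1)"

lemma exp_growth_neighbour_sum [intro]: "exp_growth f \<Longrightarrow> exp_growth (neighbour_sum f)"
  unfolding neighbour_sum_def [abs_def] by auto

lemma exp_growth_neighbour_sum_pow [intro]:
  "exp_growth f \<Longrightarrow> exp_growth ((neighbour_sum ^^ k) f)"
  by (induction k) auto

lemma neighbour_sum_pow:
  "(neighbour_sum ^^ k) f n = (\<Sum>b\<le>k. real (k choose b) * f (n + int k - 2 * int b))"
proof (induction k arbitrary: n)
  case (Suc k)
  let ?h = "\<lambda>b. f (n + int (Suc k) - 2 * int b)"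
  have 1: "(\<Sum>b\<le>k. real (k choose b) * f (n + 1 + int k - 2 * int b))
      = (\<Sum>b\<le>Suc k. real (k choose b) * ?h b)"
    by (simp add: add_ac binomial_eq_0)
  have 2: "(\<Sum>b\<le>k. real (k choose b) * f (n - 1 + int k - 2 * int b))
      = (\<Sum>b\<le>k. real (k choose b) * ?h (Suc b))"
    by (intro sum.cong refl) (simp add: algebra_simps)
  have "(\<Sum>b\<le>Suc k. real (Suc k choose b) * ?h b)
      = ?h 0 + (\<Sum>b\<le>k. real (Suc k choose Suc b) * ?h (Suc b))"
    by (subst sum.atMost_Suc_shift) simp
  also have "\<dots> = (?h 0 + (\<Sum>b\<le>k. real (k choose Suc b) * ?h (Suc b)))
      + (\<Sum>b\<le>k. real (k choose b) * ?h (Suc b))"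
    by (simp add: sum.distrib algebra_simps)
  also have "?h 0 + (\<Sum>b\<le>k. real (k choose Suc b) * ?h (Suc b)) = (\<Sum>b\<le>Suc k. real (k choose b) * ?h b)"
    by (subst sum.atMost_Suc_shift) simp
  finally show ?case
    using 1 2 by (simp add: neighbour_sum_def [of "(neighbour_sum ^^ k) f"] Suc.IH)
qed simp

lemma has_sum_antidiagonals:
  fixes g :: "nat \<times> nat \<Rightarrow> real"
  assumes "(g has_sum S) UNIV"
  shows "((\<lambda>k. \<Sum>i\<le>k. g (i, k - i)) has_sum S) UNIV"
proof -
  have bij: "bij_betw (\<lambda>(k, i). (i, k - i)) (SIGMA k:UNIV. {..k}) (UNIV :: (nat \<times> nat) set)"
    by (rule bij_betwI[where g = "\<lambda>(i, j). (i + j, i)"]) auto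
  have "((\<lambda>q. g (case q of (k, i) \<Rightarrow> (i, k - i))) has_sum S) (SIGMA k:UNIV. {..k})"
    using has_sum_reindex_bij_betw[OF bij, of g S] assms by simp
  then show ?thesis
    by (rule has_sum_SigmaD) (simp add: has_sum_finiteI)
qed

text \<open>
  Grouping the jumps by their total number \<open>k\<close>: the binomial weights of the \<open>k\<close>-step paths make up
  the \<open>k\<close>-th power of \<^const>\<open>neighbour_sum\<close>.
\<close>

theorem heat_semigroup_power_series:
  assumes "exp_growth f"
  shows "((\<lambda>k. exp (- 2 * t) * (t ^ k / fact k) * (neighbour_sum ^^ k) f n) has_sum heat_semigroup t f n) UNIV"
proof -
  let ?g = "\<lambda>p. jump_weight t p * f (endpoint n p)"
  have bij: "bij (\<lambda>(a::nat, b::nat). (b, a))"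
    by (rule bij_betwI[where g = "\<lambda>(a, b). (b, a)"]) auto
  have "((\<lambda>q. ?g (case q of (a, b) \<Rightarrow> (b, a))) has_sum heat_semigroup t f n) UNIV"
    using has_sum_reindex_bij_betw[OF bij, of ?g] heat_semigroup_has_sum[OF assms] by simp
  then have "((\<lambda>k. \<Sum>i\<le>k. ?g (k - i, i)) has_sum heat_semigroup t f n) UNIV"
    using has_sum_antidiagonals by fastforce
  moreover have "(\<Sum>i\<le>k. ?g (k - i, i)) = exp (- 2 * t) * (t ^ k / fact k) * (neighbour_sum ^^ k) f n" for k
    unfolding neighbour_sum_pow sum_distrib_left
  proof (intro sum.cong refl)
    fix i assume i: "i \<in> {..k}"
    have "t ^ k = t ^ (k - i) * t ^ i" using i by (simp flip: power_add)
    moreover have "endpoint n (k - i, i) = n + int k - 2 * int i" using i by (simp add: endpoint_def)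
    ultimately show "?g (k - i, i) = exp (- 2 * t) * (t ^ k / fact k) * (real (k choose i) * f (n + int k - 2 * int i))"
      using i by (simp add: jump_weight_def binomial_fact mult_ac)
  qed
  ultimately show ?thesis by simp
qed

lemma heat_semigroup_0: "heat_semigroup 0 f n = f n" if "exp_growth f"
proof -
  have "((\<lambda>k. exp (- 2 * 0) * (0 ^ k / fact k) * (neighbour_sum ^^ k) f n) has_sum f n) UNIV"
    by (rule has_sum_finite_neutralI[of "{0}"]) auto
  with heat_semigroup_power_series[OF that, of 0 n] show ?thesis using has_sum_unique by blast
qed

lemma heat_semigroup_neighbour_sum:
  assumes "exp_growth f"
  shows "heat_semigroup t (neighbour_sum f) n = neighbour_sum (heat_semigroup t f) n"
  unfolding neighbour_sum_def [abs_def] using assms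
    heat_semigroup_shift[OF assms, of t 1 n] heat_semigroup_shift[OF assms, of t "-1" n]
  by (subst heat_semigroup_add) auto

lemma heat_semigroup_neighbour_sum_pow:
  assumes "exp_growth f"
  shows "heat_semigroup t ((neighbour_sum ^^ k) f) = (neighbour_sum ^^ k) (heat_semigroup t f)"
  using assms by (induction k arbitrary: f) (auto simp: heat_semigroup_neighbour_sum exp_growth_neighbour_sum_pow)

lemma exp_growth_laplacian [intro]: "exp_growth f \<Longrightarrow> exp_growth (discrete_laplacian f)"
  unfolding discrete_laplacian_def [abs_def]
  by (intro exp_growth_add exp_growth_diff exp_growth_cmult exp_growth_shift exp_growth_shift_minus)

lemma exp_growth_laplacian_pow [intro]: "exp_growth f \<Longrightarrow> exp_growth ((discrete_laplacian ^^ k) f)"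
  by (induction k) auto

lemma laplacian_eq_neighbour_sum: "discrete_laplacian f n = neighbour_sum f n - 2 * f n"
  by (simp add: discrete_laplacian_def neighbour_sum_def)

lemma heat_semigroup_laplacian:
  assumes "exp_growth f"
  shows "heat_semigroup t (discrete_laplacian f) = discrete_laplacian (heat_semigroup t f)"
  unfolding laplacian_eq_neighbour_sum [abs_def] using assms
  by (auto simp: heat_semigroup_diff heat_semigroup_cmult heat_semigroup_neighbour_sum
      exp_growth_neighbour_sum exp_growth_cmult)

lemma heat_semigroup_laplacian_pow:
  assumes "exp_growth f"
  shows "heat_semigroup t ((discrete_laplacian ^^ k) f) = (discrete_laplacian ^^ k) (heat_semigroup t f)"
  using assms by (induction k arbitrary: f) (auto simp: heat_semigroup_laplacian exp_growth_laplacian_pow)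

text \<open>
  Multiplied by \<open>exp (2 * t)\<close>, the semigroup is an everywhere convergent power series in \<open>t\<close>, and
  differentiating it shifts the coefficients by one application of \<^const>\<open>neighbour_sum\<close>.
\<close>

theorem heat_equation:
  assumes "exp_growth f"
  shows "((\<lambda>t. heat_semigroup t f n) has_real_derivative heat_semigroup t (discrete_laplacian f) n) (at t)"
proof -
  define c where "c = (\<lambda>k. (neighbour_sum ^^ k) f n / fact k)"
  have P: "(\<lambda>k. c k * t ^ k) sums (exp (2 * t) * heat_semigroup t f n)" for t
    using sums_mult[OF has_sum_imp_sums[OF heat_semigroup_power_series[OF assms]], of "exp (2 * t)" t n]
    by (simp add: c_def exp_minus mult_ac)
  have P': "(\<lambda>k. diffs c k * t ^ k) sums (exp (2 * t) * heat_semigroup t (neighbour_sum f) n)" for t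
  proof -
    have "diffs c k = (neighbour_sum ^^ k) (neighbour_sum f) n / fact k" for k
    proof -
      have "(neighbour_sum ^^ Suc k) f n = (neighbour_sum ^^ k) (neighbour_sum f) n"
        by (simp only: funpow_Suc_right o_apply)
      then show ?thesis by (simp add: diffs_def c_def del: funpow.simps)
    qed
    then show ?thesis
      using sums_mult[OF has_sum_imp_sums[OF heat_semigroup_power_series[OF exp_growth_neighbour_sum[OF assms]]], of "exp (2 * t)" t n]
      by (simp add: exp_minus mult_ac)
  qed
  have "((\<lambda>t. \<Sum>k. c k * t ^ k) has_real_derivative (\<Sum>k. diffs c k * t ^ k)) (at t)"
    by (rule termdiffs_strong_converges_everywhere) (use P in \<open>auto simp: sums_iff\<close>)
  then have "((\<lambda>t. exp (2 * t) * heat_semigroup t f n) has_real_derivative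
      exp (2 * t) * heat_semigroup t (neighbour_sum f) n) (at t)"
    by (simp only: P[THEN sums_unique, symmetric] P'[THEN sums_unique, symmetric])
  from DERIV_mult[OF DERIV_fun_exp[OF DERIV_cmult[OF DERIV_ident, of "-2"]] this]
  have "((\<lambda>t. exp (-2 * t) * (exp (2 * t) * heat_semigroup t f n)) has_real_derivative
      heat_semigroup t (neighbour_sum f) n - 2 * heat_semigroup t f n) (at t)"
    by (rule DERIV_cong) (simp add: exp_minus field_simps)
  moreover have "heat_semigroup t (discrete_laplacian f) n
      = heat_semigroup t (neighbour_sum f) n - 2 * heat_semigroup t f n"
    using heat_semigroup_laplacian[OF assms, of t] heat_semigroup_neighbour_sum[OF assms, of t n]
    by (simp add: laplacian_eq_neighbour_sum)
  ultimately show ?thesis by (simp add: exp_minus flip: mult.assoc)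
qed

lemma continuous_heat_semigroup:
  assumes "exp_growth f"
  shows "continuous_on A (\<lambda>t. heat_semigroup t f n)"
  by (intro continuous_at_imp_continuous_on ballI DERIV_isCont[OF heat_equation] assms)

lemma iterated_deriv_heat_semigroup:
  assumes "exp_growth f"
  shows "(deriv ^^ k) (\<lambda>t. heat_semigroup t f n) = (\<lambda>t. heat_semigroup t ((discrete_laplacian ^^ k) f) n)"
  using assms by (induction k) (auto intro!: DERIV_imp_deriv heat_equation)

text \<open>Exponentials are eigenfunctions; they are the test functions that measure decay.\<close>

lemma heat_semigroup_exp:
  "heat_semigroup t (\<lambda>n. exp (c * real_of_int n)) n
     = exp (t * (exp c + exp (- c) - 2)) * exp (c * real_of_int n)"
proof -
  let ?q = "exp c + exp (- c)"
  have pow: "(neighbour_sum ^^ k) (\<lambda>n. exp (c * real_of_int n)) n = ?q ^ k * exp (c * real_of_int n)" for k n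
    by (induction k arbitrary: n)
      (simp_all add: neighbour_sum_def algebra_simps exp_add exp_diff exp_minus field_simps)
  have "((\<lambda>k. exp (- 2 * t) * exp (c * real_of_int n) * ((t * ?q) ^ k / fact k)) has_sum
      exp (- 2 * t) * exp (c * real_of_int n) * exp (t * ?q)) UNIV"
    by (intro has_sum_cmult_right has_sum_exp_series)
  moreover have "exp (- 2 * t) * exp (c * real_of_int n) * exp (t * ?q)
      = exp (t * (?q - 2)) * exp (c * real_of_int n)"
    by (simp add: algebra_simps flip: exp_add)
  ultimately show ?thesis
    using heat_semigroup_power_series[OF exp_growth_exp, of t c n]
    by (auto simp: pow power_mult_distrib mult_ac intro: has_sum_unique)
qed

lemma heat_semigroup_const: "heat_semigroup t (\<lambda>n. c) n = c"
  using heat_semigroup_exp[of t 0 n] heat_semigroup_cmult[of "\<lambda>_. 1" t c n] by simp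

lemma exp_abs_le: "exp (c * \<bar>x\<bar>) \<le> exp (c * x) + exp (- c * x)" for x :: real
  by (cases "x \<ge> 0") (auto simp: abs_if)

lemma exp_growth_heat_semigroup [intro]:
  assumes "exp_growth f" "t \<ge> 0"
  shows "exp_growth (heat_semigroup t f)"
proof -
  obtain C c where f: "C \<ge> 0" "c \<ge> 0" "\<And>n. \<bar>f n\<bar> \<le> C * exp (c * \<bar>real_of_int n\<bar>)"
    using exp_growthE[OF assms(1)] by blast
  let ?g = "\<lambda>n. C * (exp (c * real_of_int n) + exp (- c * real_of_int n))"
  let ?h = "\<lambda>n. C * (exp (t * (exp c + exp (- c) - 2)) * (exp (c * real_of_int n) + exp (- c * real_of_int n)))"
  have g: "exp_growth ?g" by (intro exp_growth_cmult exp_growth_add exp_growth_exp)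
  have "\<bar>f n\<bar> \<le> ?g n" for n
    using f(3)[of n] mult_left_mono[OF exp_abs_le[of c "real_of_int n"] f(1)] by linarith
  then have le: "heat_semigroup t (\<lambda>n. \<bar>f n\<bar>) n \<le> heat_semigroup t ?g n" for n
    using assms g by (intro heat_semigroup_mono) auto
  have "heat_semigroup t ?g n = ?h n" for n
    using heat_semigroup_exp[of t c n] heat_semigroup_exp[of t "-c" n]
      heat_semigroup_cmult[OF exp_growth_add[OF exp_growth_exp[of c] exp_growth_exp[of "-c"]], of t C n]
      heat_semigroup_add[OF exp_growth_exp[of c] exp_growth_exp[of "-c"], of t n]
    by (simp add: algebra_simps)
  with le have "\<bar>heat_semigroup t f n\<bar> \<le> \<bar>?h n\<bar>" for n
    using heat_semigroup_abs_le[OF assms, of n] by (smt (verit))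
  moreover have "exp_growth ?h" by (intro exp_growth_cmult exp_growth_add exp_growth_exp)
  ultimately show ?thesis by (rule exp_growth_le[rotated])
qed

text \<open>
  The product of the two exponential series, regrouped by total degree.  Absolute summability comes
  from the same computation with \<open>|f|\<close>, in which all terms are nonnegative.
\<close>

theorem heat_semigroup_semigroup:
  assumes "exp_growth f" "s \<ge> 0" "t \<ge> 0"
  shows "heat_semigroup s (heat_semigroup t f) n = heat_semigroup (s + t) f n"
proof -
  let ?T = "\<lambda>f i j. exp (- 2 * s) * (s ^ i / fact i) *
     (exp (- 2 * t) * (t ^ j / fact j) * (neighbour_sum ^^ j) ((neighbour_sum ^^ i) f) n)"
  have inner: "((\<lambda>j. ?T f i j) has_sum
      exp (- 2 * s) * (s ^ i / fact i) * (neighbour_sum ^^ i) (heat_semigroup t f) n) UNIV"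
    if "exp_growth f" for f i
    using has_sum_cmult_right[OF heat_semigroup_power_series[OF exp_growth_neighbour_sum_pow[OF that, of i], of t n]]
    unfolding heat_semigroup_neighbour_sum_pow[OF that] .
  have outer: "((\<lambda>i. exp (- 2 * s) * (s ^ i / fact i) * (neighbour_sum ^^ i) (heat_semigroup t f) n) has_sum
      heat_semigroup s (heat_semigroup t f) n) UNIV" if "exp_growth f" for f
    by (rule heat_semigroup_power_series) (use that assms in auto)
  have pos: "0 \<le> (neighbour_sum ^^ j) (\<lambda>n. \<bar>f n\<bar>) n" for j n
    by (induction j arbitrary: n) (auto simp: neighbour_sum_def)
  have dom: "\<bar>(neighbour_sum ^^ j) f n\<bar> \<le> (neighbour_sum ^^ j) (\<lambda>n. \<bar>f n\<bar>) n" for j n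
  proof (induction j arbitrary: n)
    case (Suc j)
    show ?case using Suc.IH[of "n+1"] Suc.IH[of "n-1"] by (simp add: neighbour_sum_def)
  qed auto
  have comp: "(neighbour_sum ^^ j) ((neighbour_sum ^^ i) g) = (neighbour_sum ^^ (i + j)) g" for i j g
    by (simp add: funpow_add add.commute[of i])
  have "(\<lambda>(i, j). ?T (\<lambda>n. \<bar>f n\<bar>) i j) summable_on (SIGMA i:UNIV. UNIV)"
    by (rule summable_on_SigmaI[where g = "\<lambda>i. exp (- 2 * s) * (s ^ i / fact i) * (neighbour_sum ^^ i) (heat_semigroup t (\<lambda>n. \<bar>f n\<bar>)) n"])
      (use inner[of "\<lambda>n. \<bar>f n\<bar>"] outer[of "\<lambda>n. \<bar>f n\<bar>"] assms in
        \<open>auto simp: comp exp_growth_abs pos intro: has_sum_imp_summable\<close>)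
  then have "(\<lambda>p. norm (case p of (i, j) \<Rightarrow> ?T f i j)) summable_on (SIGMA i:UNIV. UNIV)"
    by (rule Infinite_Sum.abs_summable_on_comparison_test')
      (use assms dom in \<open>auto simp: comp abs_mult intro!: mult_left_mono divide_right_mono\<close>)
  then have "(\<lambda>(i, j). ?T f i j) summable_on (SIGMA i:UNIV. UNIV)"
    using summable_on_iff_abs_summable_on_real by blast
  then have "((\<lambda>(i, j). ?T f i j) has_sum heat_semigroup s (heat_semigroup t f) n) (SIGMA i:UNIV. UNIV)"
    using inner[OF assms(1)] outer[OF assms(1)] by (intro has_sum_SigmaI) auto
  then have "((\<lambda>k. \<Sum>i\<le>k. ?T f i (k - i)) has_sum heat_semigroup s (heat_semigroup t f) n) UNIV"
    using has_sum_antidiagonals[of "\<lambda>(i, j). ?T f i j"] by simp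
  moreover have "(\<Sum>i\<le>k. ?T f i (k - i)) = exp (- 2 * (s + t)) * ((s + t) ^ k / fact k) * (neighbour_sum ^^ k) f n" for k
  proof -
    have "?T f i (k - i) = exp (- 2 * (s + t)) / fact k * (neighbour_sum ^^ k) f n *
        (real (k choose i) * s ^ i * t ^ (k - i))" if "i \<le> k" for i
      using that by (simp add: comp binomial_fact field_simps flip: exp_add)
    then have "(\<Sum>i\<le>k. ?T f i (k - i)) = (\<Sum>i\<le>k. exp (- 2 * (s + t)) / fact k * (neighbour_sum ^^ k) f n *
        (real (k choose i) * s ^ i * t ^ (k - i)))" by (intro sum.cong) auto
    also have "\<dots> = exp (- 2 * (s + t)) / fact k * (neighbour_sum ^^ k) f n * (s + t) ^ k"
      by (subst binomial_ring) (simp add: sum_distrib_left)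
    finally show ?thesis by simp
  qed
  ultimately have "((\<lambda>k. exp (- 2 * (s + t)) * ((s + t) ^ k / fact k) * (neighbour_sum ^^ k) f n)
      has_sum heat_semigroup s (heat_semigroup t f) n) UNIV" by simp
  with heat_semigroup_power_series[OF assms(1), of "s + t" n] show ?thesis
    using has_sum_unique by blast
qed

section \<open>The gradient estimate and its iteration\<close>

definition forward_difference :: "(int \<Rightarrow> real) \<Rightarrow> int \<Rightarrow> real" where
  "forward_difference f n = f (n + 1) - f n"

lemma exp_growth_forward_difference [intro]: "exp_growth f \<Longrightarrow> exp_growth (forward_difference f)"
  unfolding forward_difference_def [abs_def] by (intro exp_growth_diff exp_growth_shift)

lemma exp_growth_forward_difference_pow [intro]:
  "exp_growth f \<Longrightarrow> exp_growth ((forward_difference ^^ k) f)"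
  by (induction k) auto

lemma heat_semigroup_forward_difference:
  assumes "exp_growth f"
  shows "heat_semigroup t (forward_difference f) = forward_difference (heat_semigroup t f)"
  unfolding forward_difference_def [abs_def] using assms heat_semigroup_shift[OF assms, of t 1]
  by (auto simp: heat_semigroup_diff exp_growth_shift)

lemma heat_semigroup_forward_difference_pow:
  assumes "exp_growth f"
  shows "heat_semigroup t ((forward_difference ^^ k) f) = (forward_difference ^^ k) (heat_semigroup t f)"
  using assms
  by (induction k) (auto simp: heat_semigroup_forward_difference exp_growth_forward_difference_pow)

text \<open>
  The Laplacian is the square of the forward difference up to a unit shift.  Working with one-sided
  differences allows the gradient estimate to be iterated verbatim.
\<close>

lemma laplacian_pow_eq_forward_difference:
  "(discrete_laplacian ^^ k) f n = (forward_difference ^^ (2 * k)) f (n - int k)"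
proof (induction k arbitrary: n)
  case (Suc k)
  define F where "F = (forward_difference ^^ (2 * k)) f"
  have 1: "(discrete_laplacian ^^ Suc k) f n = F (n + 1 - int k) - 2 * F (n - int k) + F (n - 1 - int k)"
    by (simp add: discrete_laplacian_def [of "(discrete_laplacian ^^ k) f"] Suc.IH F_def)
  have 2: "(forward_difference ^^ (2 * Suc k)) f (n - int (Suc k))
      = F (n - int (Suc k) + 1 + 1) - 2 * F (n - int (Suc k) + 1) + F (n - int (Suc k))"
    unfolding F_def by (simp add: forward_difference_def [of "forward_difference _"]
        forward_difference_def [of "(forward_difference ^^ (2 * k)) f"])
  have "F (n - int (Suc k) + 1 + 1) = F (n + 1 - int k)" "F (n - int (Suc k) + 1) = F (n - int k)"
    "F (n - int (Suc k)) = F (n - 1 - int k)" by (auto intro!: arg_cong[of _ _ F])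
  then show ?case by (simp only: 1 2)
qed simp

text \<open>
  The Poisson identity \<open>E (a * g a) = t * E (g (a + 1))\<close>, an index shift in the series.
\<close>

lemma jump_weight_size_bias:
  assumes "t > 0" "((\<lambda>p. jump_weight t p * g (Suc (fst p), snd p)) has_sum x) UNIV"
  shows "((\<lambda>p. jump_weight t p * (real (fst p) / t) * g p) has_sum x) UNIV"
proof -
  let ?h = "\<lambda>p. (Suc (fst p), snd p)" and ?F = "\<lambda>p. jump_weight t p * (real (fst p) / t) * g p"
  have inj: "inj ?h" by (auto simp: inj_on_def)
  have "jump_weight t p * g (Suc (fst p), snd p) = ?F (?h p)" for p
    using assms(1) by (simp add: jump_weight_def divide_simps)
  then have "(?F has_sum x) (range ?h)"
    using assms(2) by (subst has_sum_reindex[OF inj]) (simp add: o_def)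
  moreover have "?F p = 0" if "p \<notin> range ?h" for p
  proof -
    have "fst p = 0"
    proof (rule ccontr)
      assume "fst p \<noteq> 0"
      then have "p = ?h (fst p - 1, snd p)" by (cases p) auto
      with that show False by blast
    qed
    then show ?thesis by simp
  qed
  ultimately show ?thesis
    using has_sum_cong_neutral[of "range ?h" UNIV ?F ?F x] by blast
qed

lemma jump_weight_variance:
  assumes "t > 0"
  shows "((\<lambda>p. jump_weight t p * (real (fst p) / t - 1)\<^sup>2) has_sum (1 / t)) UNIV"
proof -
  let ?w = "jump_weight t"
  have 0: "(?w has_sum 1) UNIV"
    using heat_semigroup_has_sum[of "\<lambda>_. 1" t 0] heat_semigroup_const[of t 1 0] by simp
  have 1: "((\<lambda>p. ?w p * (real (fst p) / t)) has_sum 1) UNIV"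
    using jump_weight_size_bias[OF assms, of "\<lambda>_. 1" 1] 0 by simp
  have "((\<lambda>p. ?w p * (real (Suc (fst p)) / t)) has_sum (1 + 1 / t)) UNIV"
    using has_sum_add[OF 1 has_sum_cmult_left[OF 0, of "1 / t"]]
    by (simp add: field_simps add_divide_distrib)
  then have 2: "((\<lambda>p. ?w p * (real (fst p) / t) * (real (fst p) / t)) has_sum (1 + 1 / t)) UNIV"
    using jump_weight_size_bias[OF assms, of "\<lambda>p. real (fst p) / t"] by simp
  have "((\<lambda>p. ?w p * (real (fst p) / t) * (real (fst p) / t) + ((-2) * (?w p * (real (fst p) / t)) + ?w p))
      has_sum (1 + 1 / t + (-2 * 1 + 1))) UNIV"
    by (intro has_sum_add has_sum_cmult_right 0 1 2)
  moreover have "?w p * (real (fst p) / t) * (real (fst p) / t) + ((-2) * (?w p * (real (fst p) / t)) + ?w p)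
      = ?w p * (real (fst p) / t - 1)\<^sup>2" for p
    by (simp add: power2_eq_square algebra_simps)
  ultimately show ?thesis by simp
qed

text \<open>
  By the Poisson identity the difference is the mean of \<open>(a/t - 1) * f\<close>.  Cauchy-Schwarz against the
  variance \<open>1/t\<close> gives the bound; the local form with \<open>f\<^sup>2\<close> averaged at the same site is what makes
  the estimate usable for unbounded \<open>f\<close>.
\<close>

theorem heat_gradient_estimate:
  assumes "exp_growth f" "t > 0"
  shows "(forward_difference (heat_semigroup t f) n)\<^sup>2 \<le> heat_semigroup t (\<lambda>n. (f n)\<^sup>2) n / t"
proof -
  let ?w = "jump_weight t" and ?y = "\<lambda>p. real (fst p) / t - 1" and ?f = "\<lambda>p. f (endpoint n p)"
  define x where "x = forward_difference (heat_semigroup t f) n"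
  define b where "b = heat_semigroup t (\<lambda>n. (f n)\<^sup>2) n"
  have "((\<lambda>p. ?w p * ?f (Suc (fst p), snd p)) has_sum heat_semigroup t f (n + 1)) UNIV"
    using heat_semigroup_has_sum[OF assms(1), of t "n + 1"]
    by (simp add: endpoint_def algebra_simps)
  from has_sum_add[OF jump_weight_size_bias[OF assms(2) this]
      has_sum_cmult_right[OF heat_semigroup_has_sum[OF assms(1), of t n], of "- 1"]]
  have x: "((\<lambda>p. ?w p * ?y p * ?f p) has_sum x) UNIV"
    by (simp add: x_def forward_difference_def algebra_simps)
  have b: "((\<lambda>p. ?w p * (?f p)\<^sup>2) has_sum b) UNIV"
    unfolding b_def by (rule heat_semigroup_has_sum) (use assms in auto)
  have complete_square: "l\<^sup>2 * (w * y\<^sup>2) + ((- 2 * l) * (w * y * z) + w * z\<^sup>2) = w * (l * y - z)\<^sup>2"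
    for l w y z :: real by (simp add: power2_eq_square algebra_simps)
  (* The minimiser of the quadratic form; it turns positivity into Cauchy-Schwarz. *)
  define l where "l = x * t"
  have "((\<lambda>p. l\<^sup>2 * (?w p * (?y p)\<^sup>2) + ((- 2 * l) * (?w p * ?y p * ?f p) + ?w p * (?f p)\<^sup>2))
      has_sum (l\<^sup>2 * (1 / t) + ((- 2 * l) * x + b))) UNIV"
    by (intro has_sum_add has_sum_cmult_right jump_weight_variance x b assms)
  moreover have "l\<^sup>2 * (?w p * (?y p)\<^sup>2) + ((- 2 * l) * (?w p * ?y p * ?f p) + ?w p * (?f p)\<^sup>2)
      = ?w p * (l * ?y p - ?f p)\<^sup>2" for p
    by (rule complete_square)
  ultimately have "0 \<le> l\<^sup>2 * (1 / t) + ((- 2 * l) * x + b)"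
    using assms(2) by (elim has_sum_nonneg) (auto simp: jump_weight_nonneg)
  also have "\<dots> = b - x\<^sup>2 * t"
    using assms(2) by (simp add: l_def power2_eq_square field_simps)
  finally show ?thesis using assms(2) by (simp add: x_def b_def field_simps)
qed

lemma heat_semigroup_jensen:
  assumes "exp_growth f" "t \<ge> 0"
  shows "(heat_semigroup t f n)\<^sup>2 \<le> heat_semigroup t (\<lambda>n. (f n)\<^sup>2) n"
proof -
  define x where "x = heat_semigroup t f n"
  have f2: "exp_growth (\<lambda>n. (f n)\<^sup>2)" using assms(1) by auto
  let ?q = "\<lambda>n. (f n)\<^sup>2 + ((- 2 * x) * f n + x\<^sup>2)"
  have "?q n = (f n - x)\<^sup>2" for n by (simp add: power2_eq_square algebra_simps)
  then have q: "0 \<le> ?q n" for n by simp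
  have "heat_semigroup t (\<lambda>_. 0) n \<le> heat_semigroup t ?q n"
    by (rule heat_semigroup_mono[OF exp_growth_const _ assms(2) q])
      (intro exp_growth_add exp_growth_cmult exp_growth_const assms f2)
  then have "0 \<le> heat_semigroup t ?q n" by (simp only: heat_semigroup_const)
  also have "\<dots> = heat_semigroup t (\<lambda>n. (f n)\<^sup>2) n + ((- 2 * x) * x + x\<^sup>2)"
    using assms(1) f2
    by (subst heat_semigroup_add, simp, intro exp_growth_add exp_growth_cmult exp_growth_const, simp,
        subst heat_semigroup_add, intro exp_growth_cmult, simp, simp,
        subst heat_semigroup_cmult, simp, simp only: heat_semigroup_const x_def)
  finally show ?thesis by (simp add: x_def power2_eq_square)
qed

text \<open>
  Each time step \<open>\<tau>\<close> pays for one difference, and the averages of squares compose by the semigroup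
  law.
\<close>

lemma heat_forward_difference_estimate:
  assumes "exp_growth f" "\<tau> > 0"
  shows "((forward_difference ^^ k) (heat_semigroup (real k * \<tau>) f) n)\<^sup>2
           \<le> heat_semigroup (real k * \<tau>) (\<lambda>n. (f n)\<^sup>2) n / \<tau> ^ k"
proof (induction k arbitrary: n)
  case 0
  show ?case using assms by (simp add: heat_semigroup_0 exp_growth_power)
next
  case (Suc k)
  let ?g = "(forward_difference ^^ k) (heat_semigroup (real k * \<tau>) f)"
  let ?S = "heat_semigroup (real k * \<tau>) (\<lambda>n. (f n)\<^sup>2)"
  have k\<tau>: "real k * \<tau> \<ge> 0" "\<tau> \<ge> 0" using assms by auto
  have f2: "exp_growth (\<lambda>n. (f n)\<^sup>2)" using assms by auto
  have g: "exp_growth ?g"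
    by (intro exp_growth_forward_difference_pow exp_growth_heat_semigroup assms k\<tau>)
  have sum: "real (Suc k) * \<tau> = \<tau> + real k * \<tau>" by (simp add: algebra_simps)
  have "heat_semigroup (real (Suc k) * \<tau>) f = heat_semigroup \<tau> (heat_semigroup (real k * \<tau>) f)"
    unfolding sum by (rule ext) (rule heat_semigroup_semigroup[OF assms(1) k\<tau>(2,1), symmetric])
  then have "(forward_difference ^^ Suc k) (heat_semigroup (real (Suc k) * \<tau>) f) n
      = forward_difference (heat_semigroup \<tau> ?g) n"
    using heat_semigroup_forward_difference_pow[of "heat_semigroup (real k * \<tau>) f" \<tau> k] assms k\<tau>
    by (simp add: exp_growth_heat_semigroup)
  also have "\<dots>\<^sup>2 \<le> heat_semigroup \<tau> (\<lambda>n. (?g n)\<^sup>2) n / \<tau>"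
    by (rule heat_gradient_estimate[OF g assms(2)])
  also have "\<dots> \<le> heat_semigroup \<tau> (\<lambda>n. 1 / \<tau> ^ k * ?S n) n / \<tau>"
    using Suc.IH g k\<tau> f2 assms
    by (intro divide_right_mono heat_semigroup_mono exp_growth_power exp_growth_cmult exp_growth_heat_semigroup) auto
  also have "\<dots> = 1 / \<tau> ^ k * heat_semigroup \<tau> ?S n / \<tau>"
    using f2 k\<tau> by (subst heat_semigroup_cmult) auto
  also have "heat_semigroup \<tau> ?S n = heat_semigroup (real (Suc k) * \<tau>) (\<lambda>n. (f n)\<^sup>2) n"
    unfolding sum using heat_semigroup_semigroup[OF f2 k\<tau>(2,1)] .
  finally show ?case by (simp add: mult_ac)
qed

theorem heat_laplacian_estimate:
  assumes "exp_growth f" "t > 0"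
  shows "(heat_semigroup t ((discrete_laplacian ^^ k) f) n)\<^sup>2
           \<le> (real (2 * k) / t) ^ (2 * k) * heat_semigroup t (\<lambda>n. (f n)\<^sup>2) (n - int k)"
proof (cases "k = 0")
  case True
  then show ?thesis using heat_semigroup_jensen[OF assms(1), of t n] assms(2) by simp
next
  case False
  define \<tau> where "\<tau> = t / real (2 * k)"
  have \<tau>: "\<tau> > 0" "real (2 * k) * \<tau> = t" using False assms by (auto simp: \<tau>_def)
  have "heat_semigroup t ((discrete_laplacian ^^ k) f) n
      = (forward_difference ^^ (2 * k)) (heat_semigroup t f) (n - int k)"
    using heat_semigroup_laplacian_pow[OF assms(1)] laplacian_pow_eq_forward_difference by simp
  then show ?thesis
    using heat_forward_difference_estimate[OF assms(1) \<tau>(1), of "2 * k" "n - int k"] unfolding \<tau>(2)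
    by (simp add: \<tau>_def power_divide divide_simps mult_ac)
qed

section \<open>Kernel decay and polynomially growing data\<close>

text \<open>
  The eigenvalue of the exponential with rate \<open>c\<close> is quadratic in \<open>c\<close>, so rates of order \<open>1 / sqrt t\<close>
  survive up to time \<open>t\<close> with a bounded factor.
\<close>

lemma exp_sum_minus_two_le:
  fixes c :: real
  assumes "0 \<le> c" "c \<le> 1"
  shows "exp c + exp (- c) - 2 \<le> 2 * c\<^sup>2"
proof -
  have 1: "exp c \<le> 1 + c + c\<^sup>2" using assms by (rule exp_bound)
  have pos: "1 - c + c\<^sup>2 \<ge> 0" using assms by auto
  have "1 \<le> 1 + c\<^sup>2 / 2 + c ^ 3 / 2 + c ^ 4 / 2" using assms by auto
  also have "\<dots> = (1 - c + c\<^sup>2) * (1 + c + c\<^sup>2 / 2)"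
    by (simp add: field_simps power2_eq_square power3_eq_cube power4_eq_xxxx)
  also have "\<dots> \<le> (1 - c + c\<^sup>2) * exp c"
    using exp_lower_Taylor_quadratic[OF assms(1)] pos by (intro mult_left_mono) auto
  finally have "exp (- c) \<le> 1 - c + c\<^sup>2" by (simp add: exp_minus divide_simps)
  with 1 show ?thesis by simp
qed

lemma heat_semigroup_exp_le:
  assumes "t \<ge> 1" "\<bar>c\<bar> = 1 / sqrt t"
  shows "heat_semigroup t (\<lambda>m. exp (c * real_of_int m)) n \<le> exp 2 * exp (c * real_of_int n)"
proof -
  have "c\<^sup>2 = 1 / t" using assms power2_abs[of c] by (simp add: power_divide)
  then have c: "\<bar>c\<bar> \<le> 1" "t * c\<^sup>2 = 1" "t \<ge> 0" using assms by auto
  have "exp c + exp (- c) = exp \<bar>c\<bar> + exp (- \<bar>c\<bar>)" by (simp add: abs_if)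
  then have "exp c + exp (- c) - 2 \<le> 2 * c\<^sup>2"
    using exp_sum_minus_two_le[of "\<bar>c\<bar>"] c by simp
  from mult_left_mono[OF this c(3)] have "t * (exp c + exp (- c) - 2) \<le> 2" using c by simp
  then show ?thesis unfolding heat_semigroup_exp by (intro mult_right_mono) auto
qed

lemma heat_semigroup_exp_abs_le:
  assumes "t \<ge> 1"
  shows "heat_semigroup t (\<lambda>m. exp (\<bar>real_of_int m\<bar> / sqrt t)) n \<le> 2 * exp 2 * exp (\<bar>real_of_int n\<bar> / sqrt t)"
proof -
  define c where "c = 1 / sqrt t"
  have c: "\<bar>c\<bar> = 1 / sqrt t" "\<bar>- c\<bar> = 1 / sqrt t" "c \<ge> 0" using assms by (auto simp: c_def)
  have ab: "\<bar>x\<bar> / sqrt t = c * \<bar>x\<bar>" for x by (simp add: c_def)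
  have g: "exp_growth (\<lambda>m. exp (c * \<bar>real_of_int m\<bar>))" by (rule exp_growthI[of _ 1 c]) simp
  have "heat_semigroup t (\<lambda>m. exp (c * \<bar>real_of_int m\<bar>)) n
      \<le> heat_semigroup t (\<lambda>m. exp (c * real_of_int m) + exp (- c * real_of_int m)) n"
    using assms by (intro heat_semigroup_mono exp_growth_add exp_growth_exp exp_abs_le g) auto
  also have "\<dots> = heat_semigroup t (\<lambda>m. exp (c * real_of_int m)) n
      + heat_semigroup t (\<lambda>m. exp (- c * real_of_int m)) n"
    by (intro heat_semigroup_add exp_growth_exp)
  also have "\<dots> \<le> exp 2 * exp (c * real_of_int n) + exp 2 * exp (- c * real_of_int n)"
    by (intro add_mono heat_semigroup_exp_le assms c)
  also have "\<dots> \<le> exp 2 * exp (c * \<bar>real_of_int n\<bar>) + exp 2 * exp (c * \<bar>real_of_int n\<bar>)"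
    using c by (intro add_mono mult_left_mono iffD2[OF exp_le_cancel_iff]) (auto simp: abs_if mult_le_0_iff intro: order_trans[OF _ mult_nonneg_nonneg])
  finally show ?thesis by (simp add: ab)
qed

text \<open>
  The kernel is the spatial difference of the evolved indicator of a half-line.  The gradient estimate
  therefore bounds its square by \<open>1/t\<close> times a tail probability, and the tail is exponentially small at
  scale \<open>sqrt t\<close>.
\<close>

theorem heat_kernel_exponential_bound:
  assumes "t \<ge> 1"
  shows "\<bar>heat_kernel t n\<bar> \<le> exp 1 / sqrt t * exp (- (\<bar>real_of_int n\<bar> / (2 * sqrt t)))"
proof -
  define c where "c = 1 / sqrt t"
  have c: "\<bar>c\<bar> = 1 / sqrt t" "c \<ge> 0" using assms by (auto simp: c_def)
  (* Its forward difference is the point mass at -1. *)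
  let ?f = "\<lambda>m::int. if m \<ge> 0 then 1 else 0 :: real"
  have f: "exp_growth ?f" by (rule exp_growthI[of _ 1 0]) simp
  have df: "forward_difference ?f = (\<lambda>m. if m = -1 then 1 else 0)"
    by (auto simp: forward_difference_def fun_eq_iff)
  (* The bound is strong for n \<le> 0 only; the other half follows by symmetry. *)
  have neg: "(heat_kernel t n)\<^sup>2 \<le> exp 2 / t * exp (c * real_of_int n)" for n
  proof -
    have "((\<lambda>j. heat_kernel t (n - 1 - j) * forward_difference ?f j) has_sum heat_kernel t n) UNIV"
      by (rule has_sum_finite_neutralI[of "{-1}"]) (auto simp: df)
    with heat_kernel_has_sum[OF exp_growth_forward_difference[OF f], of t "n - 1"]
    have "heat_kernel t n = heat_semigroup t (forward_difference ?f) (n - 1)"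
      using has_sum_unique by blast
    also have "\<dots> = forward_difference (heat_semigroup t ?f) (n - 1)"
      using heat_semigroup_forward_difference[OF f] by simp
    also have "\<dots>\<^sup>2 \<le> heat_semigroup t (\<lambda>m. (?f m)\<^sup>2) (n - 1) / t"
      using assms by (intro heat_gradient_estimate f) auto
    also have "\<dots> \<le> heat_semigroup t (\<lambda>m. exp (c * real_of_int m)) (n - 1) / t"
      using assms f c by (intro divide_right_mono heat_semigroup_mono exp_growth_exp exp_growth_power) auto
    also have "\<dots> \<le> exp 2 * exp (c * real_of_int (n - 1)) / t"
      using assms by (intro divide_right_mono heat_semigroup_exp_le c) auto
    also have "\<dots> \<le> exp 2 * exp (c * real_of_int n) / t"
      using assms by (intro divide_right_mono mult_left_mono iffD2[OF exp_le_cancel_iff] c) auto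
    finally show ?thesis by simp
  qed
  have sym: "heat_kernel t n = heat_kernel t (- \<bar>n\<bar>)" by (simp add: heat_kernel_def bessel_I_def)
  let ?R = "exp 1 / sqrt t * exp (- (\<bar>real_of_int n\<bar> / (2 * sqrt t)))"
  have square: "exp 2 / t * exp (c * real_of_int (- \<bar>n\<bar>)) = ?R\<^sup>2"
  proof -
    have "(exp 1 :: real)\<^sup>2 = exp 2" using exp_double[of "1 :: real"] by simp
    moreover have "(exp (- (\<bar>real_of_int n\<bar> / (2 * sqrt t))))\<^sup>2 = exp (c * real_of_int (- \<bar>n\<bar>))"
      using exp_double[of "- (\<bar>real_of_int n\<bar> / (2 * sqrt t))"] by (simp add: c_def)
    ultimately show ?thesis using assms by (simp add: power_mult_distrib power_divide)
  qed
  have "(heat_kernel t n)\<^sup>2 \<le> ?R\<^sup>2"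
    using neg[of "- \<bar>n\<bar>"] unfolding square sym[symmetric] .
  moreover have "0 \<le> ?R" using assms by auto
  ultimately show ?thesis using abs_le_square_iff[of "heat_kernel t n" ?R] by linarith
qed

lemma powr_le_exp:
  fixes x p :: real
  assumes "x \<ge> 0" "p > 0"
  shows "x powr p \<le> p powr p * exp x"
proof (cases "x = 0")
  case False
  have "x / p \<le> exp (x / p)" using exp_ge_add_one_self[of "x / p"] by linarith
  then have "(x / p) powr p \<le> exp (x / p) powr p" using assms by (intro powr_mono2) auto
  also have "\<dots> = exp x" using assms by (simp add: powr_def)
  finally show ?thesis using assms by (simp add: powr_divide divide_simps mult_ac split: if_splits)
qed (use assms in auto)

definition poly_growth :: "real \<Rightarrow> (int \<Rightarrow> real) \<Rightarrow> bool" where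
  "poly_growth \<alpha> f \<longleftrightarrow> (\<exists>A. \<forall>n. \<bar>f n\<bar> \<le> A * (1 + \<bar>real_of_int n\<bar> powr \<alpha>))"

lemma poly_growthE:
  assumes "poly_growth \<alpha> f"
  obtains A where "A \<ge> 0" "\<And>n. \<bar>f n\<bar> \<le> A * (1 + \<bar>real_of_int n\<bar> powr \<alpha>)"
proof -
  obtain A where *: "\<And>n. \<bar>f n\<bar> \<le> A * (1 + \<bar>real_of_int n\<bar> powr \<alpha>)"
    using assms unfolding poly_growth_def by blast
  have "A \<ge> 0" using *[of 0] by (auto intro: order_trans[OF abs_ge_zero])
  with * that show ?thesis by blast
qed

lemma poly_growth_imp_exp_growth:
  assumes "poly_growth \<alpha> f" "\<alpha> > 0"
  shows "exp_growth f"
proof -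
  obtain A where A: "A \<ge> 0" "\<And>n. \<bar>f n\<bar> \<le> A * (1 + \<bar>real_of_int n\<bar> powr \<alpha>)"
    using poly_growthE[OF assms(1)] by blast
  have "\<bar>f n\<bar> \<le> (A * (1 + \<alpha> powr \<alpha>)) * exp (1 * \<bar>real_of_int n\<bar>)" for n
  proof -
    have "1 + \<bar>real_of_int n\<bar> powr \<alpha> \<le> exp \<bar>real_of_int n\<bar> + \<alpha> powr \<alpha> * exp \<bar>real_of_int n\<bar>"
      using assms(2) by (intro add_mono powr_le_exp) auto
    from mult_left_mono[OF this A(1)] A(2)[of n] show ?thesis by (simp add: algebra_simps)
  qed
  then show ?thesis by (rule exp_growthI)
qed

text \<open>
  At time \<open>t \<ge> 1\<close> the square of \<open>f\<close> is at most a multiple of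
  \<open>t powr \<alpha> * exp (|m| / sqrt t)\<close>, whose heat average at time \<open>t\<close> is of the same size.
\<close>

theorem heat_laplacian_poly_growth:
  assumes "poly_growth \<alpha> f" "\<alpha> > 0"
  shows "\<exists>C\<ge>0. \<forall>t\<ge>1. \<forall>n. \<bar>heat_semigroup t ((discrete_laplacian ^^ j) f) n\<bar>
           \<le> C * t powr (\<alpha> / 2 - real j) * exp (\<bar>real_of_int n\<bar> / sqrt t)"
proof -
  obtain A where A: "A \<ge> 0" "\<And>n. \<bar>f n\<bar> \<le> A * (1 + \<bar>real_of_int n\<bar> powr \<alpha>)"
    using poly_growthE[OF assms(1)] by blast
  have f: "exp_growth f" using poly_growth_imp_exp_growth assms by blast
  define B where "B = 2 * A\<^sup>2 * (1 + (2 * \<alpha>) powr (2 * \<alpha>))"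
  define K where "K = real (2 * j) ^ (2 * j) * (B * (2 * exp 2)) * exp (real j)"
  have B: "B \<ge> 0" unfolding B_def by (intro mult_nonneg_nonneg) auto
  have K: "K \<ge> 0" unfolding K_def by (intro mult_nonneg_nonneg B) auto
  have main: "\<bar>heat_semigroup t ((discrete_laplacian ^^ j) f) n\<bar>
      \<le> sqrt K * t powr (\<alpha> / 2 - real j) * exp (\<bar>real_of_int n\<bar> / sqrt t)" if t: "t \<ge> 1" for t n
  proof -
    let ?e = "\<lambda>m. exp (\<bar>real_of_int m\<bar> / sqrt t)"
    have e1: "?e m \<ge> 1" for m using t by simp
    have eg: "exp_growth ?e" by (rule exp_growthI[of _ 1 "1 / sqrt t"]) simp
    have ta: "t powr \<alpha> \<ge> 1" using t assms(2) by (simp add: ge_one_powr_ge_zero)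
    have sq: "(f m)\<^sup>2 \<le> (B * t powr \<alpha>) * ?e m" for m
    proof -
      let ?x = "\<bar>real_of_int m\<bar>"
      have "?x powr (2 * \<alpha>) = t powr \<alpha> * (?x / sqrt t) powr (2 * \<alpha>)"
      proof -
        have "sqrt t powr (2 * \<alpha>) = t powr \<alpha>" using t by (simp add: powr_half_sqrt[symmetric] powr_powr)
        then show ?thesis using t by (simp add: powr_divide)
      qed
      also have "\<dots> \<le> t powr \<alpha> * ((2 * \<alpha>) powr (2 * \<alpha>) * exp (?x / sqrt t))"
        using t assms(2) by (intro mult_left_mono powr_le_exp) auto
      finally have 1: "?x powr (2 * \<alpha>) \<le> (2 * \<alpha>) powr (2 * \<alpha>) * (t powr \<alpha> * ?e m)" by (simp add: mult_ac)
      have 2: "1 \<le> t powr \<alpha> * ?e m" using mult_mono[OF ta e1[of m]] by simp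
      have "(f m)\<^sup>2 \<le> (A * (1 + ?x powr \<alpha>))\<^sup>2"
        using A(2)[of m] by (metis abs_ge_zero power2_abs power_mono)
      also have "\<dots> = A\<^sup>2 * (1 + ?x powr \<alpha>)\<^sup>2" by (simp add: power_mult_distrib)
      also have "\<dots> \<le> A\<^sup>2 * (2 * ((1 + (2 * \<alpha>) powr (2 * \<alpha>)) * (t powr \<alpha> * ?e m)))"
      proof (intro mult_left_mono)
        have "?x powr (2 * \<alpha>) = (?x powr \<alpha>)\<^sup>2" by (simp add: power2_eq_square flip: powr_add)
        then have "(1 + ?x powr \<alpha>)\<^sup>2 \<le> 2 * (1 + ?x powr (2 * \<alpha>))"
          using sum_squares_bound[of 1 "?x powr \<alpha>"] by (simp add: power2_sum)
        also have "\<dots> \<le> 2 * ((1 + (2 * \<alpha>) powr (2 * \<alpha>)) * (t powr \<alpha> * ?e m))"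
          using 1 2 by (simp add: distrib_right)
        finally show "(1 + ?x powr \<alpha>)\<^sup>2 \<le> 2 * ((1 + (2 * \<alpha>) powr (2 * \<alpha>)) * (t powr \<alpha> * ?e m))" .
      qed simp
      finally show ?thesis by (simp add: B_def mult_ac)
    qed
    have "heat_semigroup t (\<lambda>m. (f m)\<^sup>2) (n - int j) \<le> heat_semigroup t (\<lambda>m. (B * t powr \<alpha>) * ?e m) (n - int j)"
      using t f by (intro heat_semigroup_mono sq exp_growth_cmult exp_growth_power eg) auto
    also have "\<dots> = (B * t powr \<alpha>) * heat_semigroup t ?e (n - int j)" by (rule heat_semigroup_cmult[OF eg])
    also have "\<dots> \<le> (B * t powr \<alpha>) * (2 * exp 2 * ?e (n - int j))"
      using B t by (intro mult_left_mono heat_semigroup_exp_abs_le) auto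
    also have "?e (n - int j) \<le> exp (real j) * (?e n)\<^sup>2"
    proof -
      have "\<bar>real_of_int (n - int j)\<bar> / sqrt t \<le> (\<bar>real_of_int n\<bar> + real j) / sqrt t"
        using t by (intro divide_right_mono) auto
      also have "\<dots> \<le> \<bar>real_of_int n\<bar> / sqrt t + real j"
        using t by (simp add: add_divide_distrib divide_le_eq mult_le_cancel_left1)
      also have "\<dots> \<le> real j + 2 * (\<bar>real_of_int n\<bar> / sqrt t)"
      proof -
        have "0 \<le> \<bar>real_of_int n\<bar> / sqrt t" using t by simp
        then show ?thesis by linarith
      qed
      finally show ?thesis by (simp add: exp_double[symmetric] exp_add[symmetric])
    qed
    finally have T2: "heat_semigroup t (\<lambda>m. (f m)\<^sup>2) (n - int j)
        \<le> (B * t powr \<alpha>) * (2 * exp 2 * (exp (real j) * (?e n)\<^sup>2))"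
      using B by (simp add: mult_left_mono)
    have "(heat_semigroup t ((discrete_laplacian ^^ j) f) n)\<^sup>2
        \<le> (real (2 * j) / t) ^ (2 * j) * heat_semigroup t (\<lambda>m. (f m)\<^sup>2) (n - int j)"
      using t by (intro heat_laplacian_estimate f) auto
    also have "\<dots> \<le> (real (2 * j) / t) ^ (2 * j) * ((B * t powr \<alpha>) * (2 * exp 2 * (exp (real j) * (?e n)\<^sup>2)))"
      using t by (intro mult_left_mono T2) auto
    also have "\<dots> = K * (t powr \<alpha> / t ^ (2 * j)) * (?e n)\<^sup>2"
      by (simp add: K_def power_divide mult_ac)
    also have "t powr \<alpha> / t ^ (2 * j) = (t powr (\<alpha> / 2 - real j))\<^sup>2"
    proof -
      have "(t powr (\<alpha> / 2 - real j))\<^sup>2 = t powr (\<alpha> - real (2 * j))"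
        using t by (simp add: power2_eq_square flip: powr_add)
      also have "\<dots> = t powr \<alpha> / t powr real (2 * j)" by (rule powr_diff)
      also have "t powr real (2 * j) = t ^ (2 * j)" using t by (intro powr_realpow) auto
      finally show ?thesis by simp
    qed
    also have "K * (t powr (\<alpha> / 2 - real j))\<^sup>2 * (?e n)\<^sup>2
        = (sqrt K * t powr (\<alpha> / 2 - real j) * ?e n)\<^sup>2"
      using K by (simp add: power_mult_distrib)
    finally have "\<bar>heat_semigroup t ((discrete_laplacian ^^ j) f) n\<bar>
        \<le> \<bar>sqrt K * t powr (\<alpha> / 2 - real j) * ?e n\<bar>" by (simp only: abs_le_square_iff)
    then show ?thesis using K by (simp add: abs_mult)
  qed
  show ?thesis by (rule exI[of _ "sqrt K"]) (use main K in auto)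
qed

section \<open>Comparison of increments\<close>

text \<open>
  Pointwise domination of derivatives dominates increments.  Derivatives are compared in the
  interior, so the majorant may have an integrable singularity at an endpoint.
\<close>

lemma abs_diff_le_of_deriv_le:
  fixes \<phi> \<psi> :: "real \<Rightarrow> real"
  assumes "a \<le> b" "continuous_on {a..b} \<phi>" "continuous_on {a..b} \<psi>"
    and "\<And>x. a < x \<Longrightarrow> x < b \<Longrightarrow> (\<phi> has_real_derivative \<phi>' x) (at x)"
    and "\<And>x. a < x \<Longrightarrow> x < b \<Longrightarrow> (\<psi> has_real_derivative \<psi>' x) (at x)"
    and "\<And>x. a < x \<Longrightarrow> x < b \<Longrightarrow> \<bar>\<phi>' x\<bar> \<le> \<psi>' x"
  shows "\<bar>\<phi> b - \<phi> a\<bar> \<le> \<psi> b - \<psi> a"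
proof -
  have "\<psi> a - \<phi> a \<le> \<psi> b - \<phi> b"
  proof (rule DERIV_nonneg_imp_increasing_open[OF assms(1)])
    show "\<exists>y. ((\<lambda>x. \<psi> x - \<phi> x) has_real_derivative y) (at x) \<and> 0 \<le> y" if "a < x" "x < b" for x
      using DERIV_diff[OF assms(5,4)[OF that]] assms(6)[OF that] by fastforce
  qed (intro continuous_on_diff assms)
  moreover have "\<psi> a + \<phi> a \<le> \<psi> b + \<phi> b"
  proof (rule DERIV_nonneg_imp_increasing_open[OF assms(1)])
    show "\<exists>y. ((\<lambda>x. \<psi> x + \<phi> x) has_real_derivative y) (at x) \<and> 0 \<le> y" if "a < x" "x < b" for x
      using DERIV_add[OF assms(5,4)[OF that]] assms(6)[OF that] by fastforce
  qed (intro continuous_on_add assms)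
  ultimately show ?thesis by linarith
qed

lemma abs_diff_le_powr_integrable:
  fixes \<phi> :: "real \<Rightarrow> real"
  assumes "a \<le> b" "p > 0"
    and deriv: "\<And>x. (\<phi> has_real_derivative \<phi>' x) (at x)"
    and bound: "\<And>x. a < x \<Longrightarrow> x < b \<Longrightarrow> \<bar>\<phi>' x\<bar> \<le> B * (x - a) powr (p - 1)"
  shows "\<bar>\<phi> b - \<phi> a\<bar> \<le> B * (b - a) powr p / p"
proof -
  have "\<bar>\<phi> b - \<phi> a\<bar> \<le> B * (b - a) powr p / p - B * (a - a) powr p / p"
  proof (rule abs_diff_le_of_deriv_le[OF assms(1) _ _ deriv _ bound])
    show "continuous_on {a..b} \<phi>"
      by (intro continuous_at_imp_continuous_on ballI DERIV_isCont[OF deriv])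
    show "continuous_on {a..b} (\<lambda>x. B * (x - a) powr p / p)"
      using assms(2) by (intro continuous_intros continuous_on_powr') auto
    show "((\<lambda>x. B * (x - a) powr p / p) has_real_derivative B * (x - a) powr (p - 1)) (at x)"
      if "a < x" for x
      using that assms(2) by (auto intro!: derivative_eq_intros simp: field_simps)
  qed
  then show ?thesis using assms(2) by simp
qed

lemma abs_diff_le_powr_decay:
  fixes \<phi> :: "real \<Rightarrow> real"
  assumes "0 < a" "a \<le> b" "q > 0" "B \<ge> 0"
    and deriv: "\<And>x. (\<phi> has_real_derivative \<phi>' x) (at x)"
    and bound: "\<And>x. a < x \<Longrightarrow> x < b \<Longrightarrow> \<bar>\<phi>' x\<bar> \<le> B * x powr (- q - 1)"
  shows "\<bar>\<phi> b - \<phi> a\<bar> \<le> B * a powr (- q) / q"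
proof -
  have "\<bar>\<phi> b - \<phi> a\<bar> \<le> - (B * b powr (- q) / q) - - (B * a powr (- q) / q)"
  proof (rule abs_diff_le_of_deriv_le[OF assms(2) _ _ deriv _ bound])
    show "continuous_on {a..b} \<phi>"
      by (intro continuous_at_imp_continuous_on ballI DERIV_isCont[OF deriv])
    show "continuous_on {a..b} (\<lambda>x. - (B * x powr (- q) / q))"
      using assms(1,3) by (intro continuous_intros) auto
    show "((\<lambda>x. - (B * x powr (- q) / q)) has_real_derivative B * x powr (- q - 1)) (at x)"
      if "a < x" for x
      using that assms(1,3) by (auto intro!: derivative_eq_intros simp: field_simps)
  qed
  moreover have "B * b powr (- q) / q \<ge> 0" using assms by auto
  ultimately show ?thesis by linarith
qed

section \<open>The spaces in terms of the heat semigroup\<close>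

definition heat_order :: "real \<Rightarrow> nat" where
  "heat_order \<alpha> = nat \<lfloor>\<alpha> / 2\<rfloor> + 1"

lemma heat_order_gt: "\<alpha> / 2 < real (heat_order \<alpha>)"
  unfolding heat_order_def by linarith

lemma heat_order_minimal: "\<alpha> > 0 \<Longrightarrow> \<alpha> / 2 < real j \<Longrightarrow> heat_order \<alpha> \<le> j"
  unfolding heat_order_def by linarith

lemma poly_growth_iff_bounded:
  "poly_growth \<alpha> f \<longleftrightarrow> bounded (range (\<lambda>n. f n / (1 + \<bar>real_of_int n\<bar> powr \<alpha>)))"
proof -
  have pos: "1 + \<bar>real_of_int n\<bar> powr \<alpha> > 0" for n by (simp add: add_pos_nonneg)
  then have "\<bar>f n\<bar> \<le> A * (1 + \<bar>real_of_int n\<bar> powr \<alpha>) \<longleftrightarrow> \<bar>f n / (1 + \<bar>real_of_int n\<bar> powr \<alpha>)\<bar> \<le> A" for A n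
    by (simp add: abs_divide pos_divide_le_eq abs_of_pos)
  then show ?thesis unfolding poly_growth_def bounded_iff by auto
qed

text \<open>
  On sequences of exponential growth the semigroup is smooth in time, which gives the
  differentiability clause, and its time derivatives come from Laplacians of the data.
\<close>

lemma Lambda_H_iff:
  assumes "\<alpha> > 0"
  shows "f \<in> Lambda_H \<alpha> \<longleftrightarrow> poly_growth \<alpha> f \<and>
     (\<exists>C\<ge>0. \<forall>t>0. \<forall>n. \<bar>heat_semigroup t ((discrete_laplacian ^^ heat_order \<alpha>) f) n\<bar>
        \<le> C * t powr (\<alpha> / 2 - real (heat_order \<alpha>)))"
proof (cases "poly_growth \<alpha> f")
  case True
  then have f: "exp_growth f" using assms by (rule poly_growth_imp_exp_growth)
  have pos: "(\<exists>C>0. \<forall>t>0. \<forall>n. \<bar>u t n\<bar> \<le> C * t powr e) \<longleftrightarrow> (\<exists>C\<ge>0. \<forall>t>0. \<forall>n. \<bar>u t n\<bar> \<le> C * t powr e)"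
    for u :: "real \<Rightarrow> int \<Rightarrow> real" and e
  proof
    assume "\<exists>C\<ge>0. \<forall>t>0. \<forall>n. \<bar>u t n\<bar> \<le> C * t powr e"
    then obtain C where C: "C \<ge> 0" "\<And>t n. t > 0 \<Longrightarrow> \<bar>u t n\<bar> \<le> C * t powr e" by blast
    have "\<bar>u t n\<bar> \<le> (C + 1) * t powr e" if "t > 0" for t n
      using C(2)[OF that, of n] powr_ge_zero[of t e] unfolding distrib_right by linarith
    with C(1) show "\<exists>C>0. \<forall>t>0. \<forall>n. \<bar>u t n\<bar> \<le> C * t powr e" by (intro exI[of _ "C + 1"]) auto
  qed (use less_imp_le in blast)
  have "(deriv ^^ i) (\<lambda>s. heat_semigroup s f n) differentiable (at t)" for i n t
    unfolding iterated_deriv_heat_semigroup[OF f]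
    using heat_equation[OF exp_growth_laplacian_pow[OF f, of i]] real_differentiable_def by blast
  moreover have "- real k + \<alpha> / 2 = \<alpha> / 2 - real k" for k by simp
  ultimately show ?thesis
    using True unfolding Lambda_H_def Let_def poly_growth_iff_bounded heat_order_def[symmetric]
      iterated_deriv_heat_semigroup[OF f] mem_Collect_eq pos by metis
next
  case False
  then show ?thesis unfolding Lambda_H_def poly_growth_iff_bounded by auto
qed

text \<open>
  The gradient estimate for bounded data, where the average of \<open>g\<^sup>2\<close> is at most \<open>M\<^sup>2\<close>.
\<close>

lemma heat_laplacian_bounded:
  assumes g: "exp_growth g" and "M \<ge> 0" "\<And>n. \<bar>g n\<bar> \<le> M" "t > 0"
  shows "\<bar>heat_semigroup t ((discrete_laplacian ^^ j) g) n\<bar> \<le> (real (2 * j) / t) ^ j * M"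
proof -
  have "heat_semigroup t (\<lambda>n. (g n)\<^sup>2) (n - int j) \<le> heat_semigroup t (\<lambda>n. M\<^sup>2) (n - int j)"
    using assms by (intro heat_semigroup_mono exp_growth_power exp_growth_const g)
      (auto simp: abs_le_square_iff[symmetric])
  then have le: "heat_semigroup t (\<lambda>n. (g n)\<^sup>2) (n - int j) \<le> M\<^sup>2" by (simp add: heat_semigroup_const)
  have "(heat_semigroup t ((discrete_laplacian ^^ j) g) n)\<^sup>2
      \<le> (real (2 * j) / t) ^ (2 * j) * heat_semigroup t (\<lambda>n. (g n)\<^sup>2) (n - int j)"
    by (rule heat_laplacian_estimate[OF g assms(4)])
  also have "\<dots> \<le> (real (2 * j) / t) ^ (2 * j) * M\<^sup>2"
    using assms(4) by (intro mult_left_mono le) auto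
  also have "\<dots> = ((real (2 * j) / t) ^ j * M)\<^sup>2"
    by (simp only: power_mult_distrib power_mult[symmetric] mult.commute[of j 2])
  finally have "\<bar>heat_semigroup t ((discrete_laplacian ^^ j) g) n\<bar> \<le> \<bar>(real (2 * j) / t) ^ j * M\<bar>"
    by (simp only: abs_le_square_iff)
  also have "\<dots> = (real (2 * j) / t) ^ j * M" using assms by (intro abs_of_nonneg) auto
  finally show ?thesis .
qed

text \<open>
  Half of the time is spent on the defining bound, the other half on the additional Laplacians.
\<close>

lemma Lambda_H_heat_laplacian_bound:
  assumes "\<alpha> > 0" "f \<in> Lambda_H \<alpha>" "\<alpha> / 2 < real j"
  shows "\<exists>C\<ge>0. \<forall>t>0. \<forall>n. \<bar>heat_semigroup t ((discrete_laplacian ^^ j) f) n\<bar> \<le> C * t powr (\<alpha> / 2 - real j)"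
proof -
  define k where "k = heat_order \<alpha>"
  define i where "i = j - k"
  have j: "j = i + k" using heat_order_minimal[OF assms(1,3)] by (simp add: i_def k_def)
  obtain C where C: "C \<ge> 0"
    "\<And>t n. t > 0 \<Longrightarrow> \<bar>heat_semigroup t ((discrete_laplacian ^^ k) f) n\<bar> \<le> C * t powr (\<alpha> / 2 - real k)"
    using assms(2) unfolding Lambda_H_iff[OF assms(1)] k_def by blast
  have f: "exp_growth f" using assms(1,2) poly_growth_imp_exp_growth Lambda_H_iff by blast
  define C' where "C' = real (4 * i) ^ i * C * (1 / 2) powr (\<alpha> / 2 - real k)"
  have "\<bar>heat_semigroup t ((discrete_laplacian ^^ j) f) n\<bar> \<le> C' * t powr (\<alpha> / 2 - real j)" if t: "t > 0" for t n
  proof -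
    define g where "g = heat_semigroup (t / 2) ((discrete_laplacian ^^ k) f)"
    have g: "exp_growth g" unfolding g_def using f t by (intro exp_growth_heat_semigroup exp_growth_laplacian_pow) auto
    have "heat_semigroup t ((discrete_laplacian ^^ j) f) n
        = heat_semigroup (t / 2) (heat_semigroup (t / 2) ((discrete_laplacian ^^ j) f)) n"
      using f t by (subst heat_semigroup_semigroup) auto
    also have "heat_semigroup (t / 2) ((discrete_laplacian ^^ j) f) = (discrete_laplacian ^^ i) g"
      unfolding g_def j funpow_add o_apply
      using heat_semigroup_laplacian_pow[OF exp_growth_laplacian_pow[OF f]] by blast
    also have "\<bar>heat_semigroup (t / 2) ((discrete_laplacian ^^ i) g) n\<bar>
        \<le> (real (2 * i) / (t / 2)) ^ i * (C * (t / 2) powr (\<alpha> / 2 - real k))"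
      using t C by (intro heat_laplacian_bounded g) (auto simp: g_def)
    also have "\<dots> = C' * (t powr (\<alpha> / 2 - real k) / t powr real i)"
      using t by (simp add: C'_def powr_mult[of "1/2" t, simplified] powr_realpow power_divide mult_ac)
    also have "t powr (\<alpha> / 2 - real k) / t powr real i = t powr (\<alpha> / 2 - real j)"
      by (simp add: j powr_diff[symmetric] algebra_simps)
    finally show ?thesis .
  qed
  moreover have "C' \<ge> 0" unfolding C'_def using C by auto
  ultimately show ?thesis by blast
qed

section \<open>Local bounds and the iterated Laplacian\<close>

text \<open>
  For \<open>j > \<alpha>/2\<close> this is the global bound, weakened since \<open>s\<close> is at most the cut-off.  Smaller \<open>j\<close>
  follow by downward induction: the value at the cut-off time is known from polynomial growth, and the
  increment from \<open>s\<close> to the cut-off is controlled by the case \<open>j + 1\<close>.  The free exponent \<open>\<gamma>\<close> avoids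
  the logarithm that would appear at \<open>j = \<alpha>/2\<close>.
\<close>

lemma Lambda_H_heat_laplacian_bound_local:
  assumes "\<alpha> > 0" "f \<in> Lambda_H \<alpha>" "c \<ge> 1" "\<gamma> \<le> \<alpha> / 2" "\<gamma> < real j"
  shows "\<exists>C\<ge>0. \<forall>n. \<forall>s. 0 < s \<longrightarrow> s \<le> c * (1 + (real_of_int n)\<^sup>2) \<longrightarrow>
    \<bar>heat_semigroup s ((discrete_laplacian ^^ j) f) n\<bar>
      \<le> C * (c * (1 + (real_of_int n)\<^sup>2)) powr (\<alpha> / 2 - \<gamma>) * s powr (\<gamma> - real j)"
proof -
  define R where "R = (\<lambda>n::int. c * (1 + (real_of_int n)\<^sup>2))"
  have R: "R n \<ge> 1" "(real_of_int n)\<^sup>2 \<le> R n" for n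
  proof -
    have le: "1 * (1 + (real_of_int n)\<^sup>2) \<le> R n" unfolding R_def using assms(3) by (intro mult_right_mono) auto
    show "R n \<ge> 1" by (rule order_trans[OF _ le]) simp
    show "(real_of_int n)\<^sup>2 \<le> R n" by (rule order_trans[OF _ le]) simp
  qed
  define P where "P = (\<lambda>j. \<exists>C\<ge>0. \<forall>n. \<forall>s. 0 < s \<longrightarrow> s \<le> R n \<longrightarrow>
    \<bar>heat_semigroup s ((discrete_laplacian ^^ j) f) n\<bar> \<le> C * R n powr (\<alpha> / 2 - \<gamma>) * s powr (\<gamma> - real j))"
  have large: "P j" if j: "\<alpha> / 2 < real j" for j
  proof -
    obtain C where C: "C \<ge> 0"
      "\<And>t n. t > 0 \<Longrightarrow> \<bar>heat_semigroup t ((discrete_laplacian ^^ j) f) n\<bar> \<le> C * t powr (\<alpha> / 2 - real j)"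
      using Lambda_H_heat_laplacian_bound[OF assms(1,2) j] by blast
    have "\<bar>heat_semigroup s ((discrete_laplacian ^^ j) f) n\<bar> \<le> C * R n powr (\<alpha> / 2 - \<gamma>) * s powr (\<gamma> - real j)"
      if "0 < s" "s \<le> R n" for n s
    proof -
      have "s powr (\<alpha> / 2 - real j) = s powr (\<alpha> / 2 - \<gamma>) * s powr (\<gamma> - real j)"
        by (simp flip: powr_add)
      also have "\<dots> \<le> R n powr (\<alpha> / 2 - \<gamma>) * s powr (\<gamma> - real j)"
        using that assms(4) by (intro mult_right_mono powr_mono2) auto
      finally show ?thesis using C(2)[OF that(1), of n] C(1)
        by (simp add: mult.assoc) (meson mult_left_mono order_trans)
    qed
    then show ?thesis unfolding P_def using C(1) by blast
  qed
  have step: "P j" if Suc: "P (Suc j)" and \<gamma>: "\<gamma> < real j" for j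
  proof -
    obtain C where C: "C \<ge> 0" "\<And>n s. 0 < s \<Longrightarrow> s \<le> R n \<Longrightarrow>
       \<bar>heat_semigroup s ((discrete_laplacian ^^ Suc j) f) n\<bar> \<le> C * R n powr (\<alpha> / 2 - \<gamma>) * s powr (\<gamma> - real (Suc j))"
      using Suc unfolding P_def by blast
    have pg: "poly_growth \<alpha> f" using assms(1,2) Lambda_H_iff by blast
    have f: "exp_growth ((discrete_laplacian ^^ j) f)"
      using poly_growth_imp_exp_growth[OF pg assms(1)] by blast
    obtain D where D: "D \<ge> 0" "\<And>t n. t \<ge> 1 \<Longrightarrow> \<bar>heat_semigroup t ((discrete_laplacian ^^ j) f) n\<bar>
           \<le> D * t powr (\<alpha> / 2 - real j) * exp (\<bar>real_of_int n\<bar> / sqrt t)"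
      using heat_laplacian_poly_growth[OF pg assms(1)] by blast
    have "\<bar>heat_semigroup s ((discrete_laplacian ^^ j) f) n\<bar>
        \<le> (D * exp 1 + C / (real j - \<gamma>)) * R n powr (\<alpha> / 2 - \<gamma>) * s powr (\<gamma> - real j)"
      if s: "0 < s" "s \<le> R n" for n s
    proof -
      let ?u = "\<lambda>s. heat_semigroup s ((discrete_laplacian ^^ j) f) n"
      have "\<bar>?u (R n) - ?u s\<bar> \<le> (C * R n powr (\<alpha> / 2 - \<gamma>)) * s powr (- (real j - \<gamma>)) / (real j - \<gamma>)"
      proof (rule abs_diff_le_powr_decay[OF s _ _ heat_equation[OF f]])
        show "\<bar>heat_semigroup x (discrete_laplacian ((discrete_laplacian ^^ j) f)) n\<bar>
            \<le> C * R n powr (\<alpha> / 2 - \<gamma>) * x powr (- (real j - \<gamma>) - 1)" if "s < x" "x < R n" for x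
          using C(2)[of x n] that s by (simp add: algebra_simps)
      qed (use \<gamma> C in auto)
      moreover have "\<bar>?u (R n)\<bar> \<le> (D * exp 1) * (R n powr (\<alpha> / 2 - \<gamma>) * s powr (\<gamma> - real j))"
      proof -
        have "\<bar>real_of_int n\<bar> \<le> sqrt (R n)" using R(2)[of n] by (simp add: real_le_rsqrt)
        then have "exp (\<bar>real_of_int n\<bar> / sqrt (R n)) \<le> exp 1" using R(1)[of n] by simp
        moreover have "R n powr (\<alpha> / 2 - real j) \<le> R n powr (\<alpha> / 2 - \<gamma>) * s powr (\<gamma> - real j)"
        proof -
          have "R n powr (\<alpha> / 2 - real j) = R n powr (\<alpha> / 2 - \<gamma>) * R n powr (\<gamma> - real j)"
            by (simp flip: powr_add)
          also have "\<dots> \<le> R n powr (\<alpha> / 2 - \<gamma>) * s powr (\<gamma> - real j)"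
            using s \<gamma> by (intro mult_left_mono powr_mono2') auto
          finally show ?thesis .
        qed
        ultimately have "D * R n powr (\<alpha> / 2 - real j) * exp (\<bar>real_of_int n\<bar> / sqrt (R n))
            \<le> D * (R n powr (\<alpha> / 2 - \<gamma>) * s powr (\<gamma> - real j)) * exp 1"
          using D(1) by (intro mult_mono mult_left_mono) auto
        then show ?thesis using D(2)[OF R(1), of n n] by (simp add: mult_ac)
      qed
      ultimately show ?thesis by (simp add: algebra_simps)
    qed
    moreover have "D * exp 1 + C / (real j - \<gamma>) \<ge> 0" using C D \<gamma> by auto
    ultimately show ?thesis unfolding P_def by blast
  qed
  have "\<gamma> < real j \<Longrightarrow> P j" if "j \<le> heat_order \<alpha>" for j
    using that
  proof (induction rule: inc_induct)
    case base
    then show ?case using large heat_order_gt by blast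
  next
    case (step j)
    then show ?case using \<open>\<And>j. P (Suc j) \<Longrightarrow> \<gamma> < real j \<Longrightarrow> P j\<close> by auto
  qed
  moreover have "P j" if "heat_order \<alpha> \<le> j"
    using large[of j] heat_order_gt[of \<alpha>] that by (auto intro: less_le_trans)
  ultimately have "P j" using assms(5) nat_le_linear by blast
  then show ?thesis unfolding P_def R_def .
qed

lemma poly_growthI_square:
  assumes "C \<ge> 0" "p \<ge> 0" "c \<ge> 0" "\<And>n. \<bar>f n\<bar> \<le> C * (c * (1 + (real_of_int n)\<^sup>2)) powr p"
  shows "poly_growth (2 * p) f"
proof -
  have "\<bar>f n\<bar> \<le> (C * (2 * c) powr p) * (1 + \<bar>real_of_int n\<bar> powr (2 * p))" for n
  proof -
    let ?x = "\<bar>real_of_int n\<bar>"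
    have "(1 + (real_of_int n)\<^sup>2) powr p \<le> (2 * max 1 (?x\<^sup>2)) powr p"
      using assms(2) by (intro powr_mono2) auto
    also have "\<dots> = 2 powr p * max 1 (?x\<^sup>2) powr p" by (simp add: powr_mult)
    also have "max 1 (?x\<^sup>2) powr p \<le> 1 + ?x powr (2 * p)"
    proof (cases "?x\<^sup>2 \<le> 1")
      case False
      then have "?x \<noteq> 0" by auto
      then have "?x\<^sup>2 = ?x powr 2" by simp
      then have "(?x\<^sup>2) powr p = ?x powr (2 * p)" by (simp only: powr_powr)
      with False show ?thesis by (simp add: max_def)
    qed (auto simp: max_def)
    finally have "(1 + (real_of_int n)\<^sup>2) powr p \<le> 2 powr p * (1 + ?x powr (2 * p))" by simp
    then have "C * c powr p * (1 + (real_of_int n)\<^sup>2) powr p \<le> C * c powr p * (2 powr p * (1 + ?x powr (2 * p)))"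
      using assms(1) by (intro mult_left_mono) auto
    then show ?thesis using assms(4)[of n] assms(3) by (simp add: powr_mult mult_ac)
  qed
  then show ?thesis unfolding poly_growth_def by blast
qed

text \<open>
  The derivative of \<open>s \<mapsto> T\<^sub>s \<Delta>\<^sup>j f(n)\<close> is integrable at \<open>s = 0\<close> because \<open>\<gamma>\<close> can be chosen above
  \<open>j\<close>; hence the value at \<open>0\<close> differs from the one at time \<open>1 + n\<^sup>2\<close> by a quantity of the right size.
\<close>

lemma Lambda_H_laplacian_poly_growth:
  assumes "\<alpha> > 0" "f \<in> Lambda_H \<alpha>" "real j < \<alpha> / 2"
  shows "poly_growth (\<alpha> - 2 * real j) ((discrete_laplacian ^^ j) f)"
proof -
  define R where "R = (\<lambda>n::int. 1 * (1 + (real_of_int n)\<^sup>2))"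
  have R: "R n \<ge> 1" "(real_of_int n)\<^sup>2 \<le> R n" for n by (auto simp: R_def)
  (* Any exponent in (j, j + 1) not exceeding \<alpha>/2 would do. *)
  define \<gamma> where "\<gamma> = min (\<alpha> / 2) (real j + 1 / 2)"
  have \<gamma>: "\<gamma> \<le> \<alpha> / 2" "\<gamma> < real (Suc j)" "\<gamma> - real j > 0" using assms(3) by (auto simp: \<gamma>_def min_def)
  obtain C where C: "C \<ge> 0" "\<And>n s. 0 < s \<Longrightarrow> s \<le> R n \<Longrightarrow>
       \<bar>heat_semigroup s ((discrete_laplacian ^^ Suc j) f) n\<bar> \<le> C * R n powr (\<alpha> / 2 - \<gamma>) * s powr (\<gamma> - real (Suc j))"
    using Lambda_H_heat_laplacian_bound_local[OF assms(1,2) _ \<gamma>(1,2), of 1] unfolding R_def by auto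
  have pg: "poly_growth \<alpha> f" using assms(1,2) Lambda_H_iff by blast
  have f: "exp_growth ((discrete_laplacian ^^ j) f)"
    using poly_growth_imp_exp_growth[OF pg assms(1)] by blast
  obtain D where D: "D \<ge> 0" "\<And>t n. t \<ge> 1 \<Longrightarrow> \<bar>heat_semigroup t ((discrete_laplacian ^^ j) f) n\<bar>
         \<le> D * t powr (\<alpha> / 2 - real j) * exp (\<bar>real_of_int n\<bar> / sqrt t)"
    using heat_laplacian_poly_growth[OF pg assms(1)] by blast
  define K where "K = C / (\<gamma> - real j) + D * exp 1"
  have "\<bar>(discrete_laplacian ^^ j) f n\<bar> \<le> K * R n powr (\<alpha> / 2 - real j)" for n
  proof -
    let ?u = "\<lambda>s. heat_semigroup s ((discrete_laplacian ^^ j) f) n"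
    have "\<bar>?u (R n) - ?u 0\<bar> \<le> (C * R n powr (\<alpha> / 2 - \<gamma>)) * (R n - 0) powr (\<gamma> - real j) / (\<gamma> - real j)"
    proof (rule abs_diff_le_powr_integrable[OF _ \<gamma>(3) heat_equation[OF f]])
      show "\<bar>heat_semigroup x (discrete_laplacian ((discrete_laplacian ^^ j) f)) n\<bar>
            \<le> C * R n powr (\<alpha> / 2 - \<gamma>) * (x - 0) powr (\<gamma> - real j - 1)" if "0 < x" "x < R n" for x
        using C(2)[of x n] that by (simp add: algebra_simps)
    qed (use R(1)[of n] in auto)
    also have "\<dots> = C / (\<gamma> - real j) * R n powr (\<alpha> / 2 - real j)"
      by (simp add: algebra_simps flip: powr_add)
    finally have 1: "\<bar>?u (R n) - (discrete_laplacian ^^ j) f n\<bar> \<le> C / (\<gamma> - real j) * R n powr (\<alpha> / 2 - real j)"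
      using heat_semigroup_0[OF f] by simp
    have "\<bar>real_of_int n\<bar> \<le> sqrt (R n)" using R(2)[of n] by (simp add: real_le_rsqrt)
    then have "exp (\<bar>real_of_int n\<bar> / sqrt (R n)) \<le> exp 1" using R(1)[of n] by simp
    then have "D * R n powr (\<alpha> / 2 - real j) * exp (\<bar>real_of_int n\<bar> / sqrt (R n)) \<le> D * R n powr (\<alpha> / 2 - real j) * exp 1"
      using D(1) by (intro mult_left_mono) auto
    with 1 D(2)[OF R(1), of n n] show ?thesis unfolding K_def distrib_right by (simp add: mult_ac)
  qed
  moreover have "K \<ge> 0" unfolding K_def using C D \<gamma> by auto
  ultimately have "poly_growth (2 * (\<alpha> / 2 - real j)) ((discrete_laplacian ^^ j) f)"
    unfolding R_def using assms(3) by (intro poly_growthI_square[of K _ 1]) auto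
  then show ?thesis by (simp add: algebra_simps)
qed

lemma uminus_laplacian_pow:
  "((\<lambda>g n. - discrete_laplacian g n) ^^ m) f = (\<lambda>n. (-1) ^ m * (discrete_laplacian ^^ m) f n)"
  by (induction m) (auto simp: discrete_laplacian_def fun_eq_iff algebra_simps)

theorem Lambda_H_iterated_laplacian:
  assumes "\<alpha> > 0" "f \<in> Lambda_H \<alpha>" "real m < \<alpha> / 2"
  shows "((\<lambda>g n. - discrete_laplacian g n) ^^ m) f \<in> Lambda_H (\<alpha> - 2 * real m)"
proof -
  let ?\<alpha> = "\<alpha> - 2 * real m" and ?g = "(discrete_laplacian ^^ m) f"
  have \<alpha>': "?\<alpha> > 0" using assms(3) by simp
  have pg: "poly_growth ?\<alpha> ?g" by (rule Lambda_H_laplacian_poly_growth[OF assms])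
  have g: "exp_growth ?g" by (rule poly_growth_imp_exp_growth[OF pg \<alpha>'])
  have "?\<alpha> / 2 = \<alpha> / 2 - real m" by (simp add: field_simps)
  have "\<alpha> / 2 < real (heat_order ?\<alpha> + m)" using heat_order_gt[of ?\<alpha>] by (simp add: field_simps)
  from Lambda_H_heat_laplacian_bound[OF assms(1,2) this]
  obtain C where C: "C \<ge> 0" "\<And>t n. t > 0 \<Longrightarrow>
     \<bar>heat_semigroup t ((discrete_laplacian ^^ heat_order ?\<alpha>) ?g) n\<bar> \<le> C * t powr (\<alpha> / 2 - real (heat_order ?\<alpha> + m))"
    unfolding funpow_add o_apply by blast
  have lin: "(discrete_laplacian ^^ k) (\<lambda>n. (-1) ^ m * ?g n) = (\<lambda>n. (-1) ^ m * (discrete_laplacian ^^ k) ?g n)" for k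
    by (induction k) (auto simp: discrete_laplacian_def fun_eq_iff algebra_simps)
  have abs: "\<bar>heat_semigroup t ((discrete_laplacian ^^ k) (\<lambda>n. (-1) ^ m * ?g n)) n\<bar>
      = \<bar>heat_semigroup t ((discrete_laplacian ^^ k) ?g) n\<bar>" for t k n
    unfolding lin using g by (subst heat_semigroup_cmult) (auto simp: abs_mult)
  have "poly_growth ?\<alpha> (\<lambda>n. (-1) ^ m * ?g n)"
    using pg unfolding poly_growth_def by (simp add: abs_mult)
  moreover have "\<alpha> / 2 - real (heat_order ?\<alpha> + m) = ?\<alpha> / 2 - real (heat_order ?\<alpha>)"
    by (simp add: field_simps)
  ultimately show ?thesis
    unfolding uminus_laplacian_pow Lambda_H_iff[OF \<alpha>'] abs using C by metis
qed

section \<open>Iterated differences in time\<close>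

definition step_difference :: "real \<Rightarrow> (real \<Rightarrow> real) \<Rightarrow> real \<Rightarrow> real" where
  "step_difference \<tau> w t = w (t + \<tau>) - w t"

text \<open>
  The coefficients are signed binomial coefficients.  The expansion gives measurability in \<open>\<tau>\<close> and the
  termwise bound for large \<open>\<tau>\<close>.
\<close>

lemma step_difference_pow_sum:
  "\<exists>c::nat \<Rightarrow> real. \<forall>\<tau> w t. (step_difference \<tau> ^^ K) w t = (\<Sum>i\<le>K. c i * w (t + real i * \<tau>))"
proof (induction K)
  case (Suc K)
  then obtain c :: "nat \<Rightarrow> real" where
    c: "\<And>\<tau> w t. (step_difference \<tau> ^^ K) w t = (\<Sum>i\<le>K. c i * w (t + real i * \<tau>))" by blast
  define d where "d = (\<lambda>i. (if i = 0 then 0 else c (i - 1)) - (if i \<le> K then c i else 0))"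
  have "(step_difference \<tau> ^^ Suc K) w t = (\<Sum>i\<le>Suc K. d i * w (t + real i * \<tau>))" for \<tau> w t
  proof -
    let ?w = "\<lambda>i. w (t + real i * \<tau>)"
    have "(\<Sum>i\<le>Suc K. d i * ?w i) = (\<Sum>i\<le>Suc K. (if i = 0 then 0 else c (i - 1)) * ?w i)
        - (\<Sum>i\<le>Suc K. (if i \<le> K then c i else 0) * ?w i)"
      unfolding d_def left_diff_distrib sum_subtractf ..
    also have "(\<Sum>i\<le>Suc K. (if i = 0 then 0 else c (i - 1)) * ?w i) = (\<Sum>i\<le>K. c i * ?w (Suc i))"
      by (subst sum.atMost_Suc_shift) simp
    also have "(\<Sum>i\<le>Suc K. (if i \<le> K then c i else 0) * ?w i) = (\<Sum>i\<le>K. c i * ?w i)"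
      by simp
    also have "(\<Sum>i\<le>K. c i * ?w (Suc i)) - (\<Sum>i\<le>K. c i * ?w i) = (step_difference \<tau> ^^ Suc K) w t"
      by (simp add: step_difference_def [of _ "(step_difference \<tau> ^^ K) w"] c algebra_simps)
    finally show ?thesis by simp
  qed
  then show ?case by blast
qed (auto intro: exI[of _ "\<lambda>_. 1"])

text \<open>
  The singular weight is a product of \<open>K + 1\<close> equal integrable weights, and each difference consumes
  one of them: along an increment of length \<open>\<tau>\<close> starting at \<open>s\<close>, all factors but one are bounded by
  their value at \<open>s\<close>, and the last one is integrated.
\<close>

lemma iterated_step_difference_bound_aux:
  fixes w :: "nat \<Rightarrow> real \<Rightarrow> real"
  assumes "\<And>i s. (w i has_real_derivative w (Suc i) s) (at s)"
    and \<epsilon>: "0 < \<epsilon>" "\<epsilon> \<le> 1" and \<tau>: "\<tau> > 0" and "M \<ge> 0"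
    and "\<And>s. 0 < s \<Longrightarrow> s \<le> real (Suc K) * \<tau> \<Longrightarrow> \<bar>w (Suc K) (t + s)\<bar> \<le> M * s powr (real (Suc K) * (\<epsilon> - 1))"
  shows "\<bar>(step_difference \<tau> ^^ Suc K) (w 0) t\<bar> \<le> M * (\<tau> powr \<epsilon> / \<epsilon>) ^ Suc K"
  using assms(1,5,6)
proof (induction K arbitrary: w M)
  case 0
  have "\<bar>w 0 (t + \<tau>) - w 0 t\<bar> \<le> M * (t + \<tau> - t) powr \<epsilon> / \<epsilon>"
  proof (rule abs_diff_le_powr_integrable[OF _ \<epsilon>(1) 0(1)])
    show "\<bar>w (Suc 0) x\<bar> \<le> M * (x - t) powr (\<epsilon> - 1)" if "t < x" "x < t + \<tau>" for x
      using 0(3)[of "x - t"] that by simp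
  qed (use \<tau> in simp)
  then show ?case by (simp add: step_difference_def)
next
  case (Suc K)
  define v where "v = (\<lambda>i s. w i (s + \<tau>) - w i s)"
  have v: "(v i has_real_derivative v (Suc i) s) (at s)" for i s
    unfolding v_def by (intro DERIV_diff Suc.prems(1) DERIV_shift[THEN iffD1])
  have "\<bar>v (Suc K) (t + s)\<bar> \<le> M * (\<tau> powr \<epsilon> / \<epsilon>) * s powr (real (Suc K) * (\<epsilon> - 1))"
    if s: "0 < s" "s \<le> real (Suc K) * \<tau>" for s
  proof -
    have "\<bar>w (Suc K) (t + s + \<tau>) - w (Suc K) (t + s)\<bar>
        \<le> (M * s powr (real (Suc K) * (\<epsilon> - 1))) * (t + s + \<tau> - (t + s)) powr \<epsilon> / \<epsilon>"
    proof (rule abs_diff_le_powr_integrable[OF _ \<epsilon>(1) Suc.prems(1)])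
      fix x assume x: "t + s < x" "x < t + s + \<tau>"
      have "\<bar>w (Suc (Suc K)) x\<bar> \<le> M * (x - t) powr (real (Suc (Suc K)) * (\<epsilon> - 1))"
        using Suc.prems(3)[of "x - t"] x s by (simp add: algebra_simps)
      also have "(x - t) powr (real (Suc (Suc K)) * (\<epsilon> - 1))
          = (x - t) powr (real (Suc K) * (\<epsilon> - 1)) * (x - t) powr (\<epsilon> - 1)"
        by (simp add: algebra_simps flip: powr_add)
      also have "M * \<dots> \<le> M * (s powr (real (Suc K) * (\<epsilon> - 1)) * (x - (t + s)) powr (\<epsilon> - 1))"
        using x s \<epsilon> Suc.prems(2) by (intro mult_left_mono mult_mono powr_mono2') (auto intro: mult_nonneg_nonpos)
      finally show "\<bar>w (Suc (Suc K)) x\<bar> \<le> M * s powr (real (Suc K) * (\<epsilon> - 1)) * (x - (t + s)) powr (\<epsilon> - 1)"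
        by (simp add: mult_ac)
    qed (use \<tau> in simp)
    then show ?thesis by (simp add: v_def mult_ac)
  qed
  then have "\<bar>(step_difference \<tau> ^^ Suc K) (v 0) t\<bar> \<le> M * (\<tau> powr \<epsilon> / \<epsilon>) * (\<tau> powr \<epsilon> / \<epsilon>) ^ Suc K"
    using Suc.prems(2) \<epsilon> by (intro Suc.IH v) auto
  moreover have "v 0 = step_difference \<tau> (w 0)" by (auto simp: v_def step_difference_def)
  ultimately show ?case by (simp add: funpow_swap1 mult_ac)
qed

text \<open>The case \<open>\<epsilon> = \<gamma> / K\<close> of the preceding lemma.\<close>

theorem iterated_step_difference_bound:
  fixes w :: "nat \<Rightarrow> real \<Rightarrow> real"
  assumes "\<And>i s. (w i has_real_derivative w (Suc i) s) (at s)"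
    and \<gamma>: "0 < \<gamma>" "\<gamma> \<le> real K" and "\<tau> > 0" "M \<ge> 0"
    and "\<And>s. 0 < s \<Longrightarrow> s \<le> real K * \<tau> \<Longrightarrow> \<bar>w K (t + s)\<bar> \<le> M * s powr (\<gamma> - real K)"
  shows "\<bar>(step_difference \<tau> ^^ K) (w 0) t\<bar> \<le> M * (real K / \<gamma>) ^ K * \<tau> powr \<gamma>"
proof -
  obtain k where K: "K = Suc k" using \<gamma> by (cases K) auto
  define \<epsilon> where "\<epsilon> = \<gamma> / real K"
  have \<epsilon>: "0 < \<epsilon>" "\<epsilon> \<le> 1" "real K * (\<epsilon> - 1) = \<gamma> - real K"
    using \<gamma> by (auto simp: \<epsilon>_def field_simps)
  have "\<bar>(step_difference \<tau> ^^ Suc k) (w 0) t\<bar> \<le> M * (\<tau> powr \<epsilon> / \<epsilon>) ^ Suc k"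
    by (rule iterated_step_difference_bound_aux[where w = w, OF assms(1) \<epsilon>(1,2) assms(4,5)])
      (use assms(6) \<epsilon>(3) K in auto)
  also have "(\<tau> powr \<epsilon> / \<epsilon>) ^ Suc k = (real K / \<gamma>) ^ K * (\<tau> powr \<epsilon>) ^ K"
    unfolding K[symmetric] by (simp add: \<epsilon>_def power_divide power_mult_distrib mult.commute)
  also have "(\<tau> powr \<epsilon>) ^ K = \<tau> powr \<gamma>"
  proof -
    have "(\<tau> powr \<epsilon>) ^ K = (\<tau> powr \<epsilon>) powr real K" using assms(4) by (simp add: powr_realpow)
    also have "\<dots> = \<tau> powr \<gamma>" using \<gamma> by (simp add: powr_powr \<epsilon>_def)
    finally show ?thesis .
  qed
  finally show ?thesis unfolding K by (simp add: mult.assoc)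
qed

lemma exp_growth_heat_difference [intro]:
  "exp_growth f \<Longrightarrow> \<tau> \<ge> 0 \<Longrightarrow> exp_growth (heat_difference \<tau> f)"
  unfolding heat_difference_def [abs_def] by auto

lemma exp_growth_heat_difference_pow [intro]:
  "exp_growth f \<Longrightarrow> \<tau> \<ge> 0 \<Longrightarrow> exp_growth ((heat_difference \<tau> ^^ K) f)"
  by (induction K) auto

lemma heat_difference_laplacian:
  assumes "exp_growth f"
  shows "heat_difference \<tau> (discrete_laplacian f) = discrete_laplacian (heat_difference \<tau> f)"
  by (rule ext) (simp add: heat_difference_def [abs_def] heat_semigroup_laplacian[OF assms] discrete_laplacian_def)

lemma heat_difference_laplacian_pow:
  assumes "exp_growth f"
  shows "heat_difference \<tau> ((discrete_laplacian ^^ j) f) = (discrete_laplacian ^^ j) (heat_difference \<tau> f)"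
  using assms by (induction j) (auto simp: heat_difference_laplacian exp_growth_laplacian_pow)

lemma heat_difference_pow_laplacian_pow:
  assumes "exp_growth f" "\<tau> \<ge> 0"
  shows "(heat_difference \<tau> ^^ K) ((discrete_laplacian ^^ j) f) = (discrete_laplacian ^^ j) ((heat_difference \<tau> ^^ K) f)"
  using assms by (induction K) (auto simp: heat_difference_laplacian_pow exp_growth_heat_difference_pow)

lemma heat_semigroup_heat_difference_pow:
  assumes "exp_growth f" "\<tau> \<ge> 0" "t \<ge> 0"
  shows "heat_semigroup t ((heat_difference \<tau> ^^ K) f) n = (step_difference \<tau> ^^ K) (\<lambda>s. heat_semigroup s f n) t"
  using assms(3)
proof (induction K arbitrary: t)
  case (Suc K)
  let ?g = "(heat_difference \<tau> ^^ K) f"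
  have g: "exp_growth ?g" using assms by auto
  have "heat_difference \<tau> ?g = (\<lambda>n. heat_semigroup \<tau> ?g n - ?g n)"
    by (rule ext) (rule heat_difference_def)
  then have "heat_semigroup t (heat_difference \<tau> ?g) n = heat_semigroup t (heat_semigroup \<tau> ?g) n - heat_semigroup t ?g n"
    using heat_semigroup_diff[OF exp_growth_heat_semigroup[OF g assms(2)] g, of t n] by simp
  also have "heat_semigroup t (heat_semigroup \<tau> ?g) n = heat_semigroup (t + \<tau>) ?g n"
    by (rule heat_semigroup_semigroup[OF g Suc.prems assms(2)])
  finally show ?case
    using Suc.IH[of "t + \<tau>"] Suc.IH[of t] Suc.prems assms(2)
    by (simp add: step_difference_def [of _ "(step_difference \<tau> ^^ K) _"])
qed simp

lemma heat_difference_pow_eq: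
  assumes "exp_growth f" "\<tau> \<ge> 0"
  shows "(heat_difference \<tau> ^^ K) f n = (step_difference \<tau> ^^ K) (\<lambda>s. heat_semigroup s f n) 0"
  using heat_semigroup_heat_difference_pow[OF assms, of 0 K n] heat_semigroup_0 assms by (simp add: exp_growth_heat_difference_pow)

section \<open>Integrals over time\<close>

text \<open>
  One power integrable at \<open>0\<close> up to the cut-off \<open>R\<close>, another integrable at infinity beyond it.  This
  is the shape of the bounds in \<open>\<tau>\<close> met below.
\<close>

definition power_majorant :: "real \<Rightarrow> real \<Rightarrow> real \<Rightarrow> real \<Rightarrow> real \<Rightarrow> real \<Rightarrow> real" where
  "power_majorant A p B q R \<tau> =
     A * (indicator {0<..R} \<tau> * \<tau> powr (p - 1)) + B * (indicator {R..} \<tau> * \<tau> powr (- q - 1))"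

lemma integral_of_nonneg_has_integral:
  fixes f :: "real \<Rightarrow> real"
  assumes "f \<in> borel_measurable borel" "\<And>x. f x \<ge> 0" "(f has_integral I) UNIV"
  shows "integrable lborel f \<and> integral\<^sup>L lborel f = I"
proof -
  have I: "I \<ge> 0" using has_integral_nonneg[OF assms(3)] assms(2) by auto
  have "integral\<^sup>N lborel f = ennreal I"
    by (rule nn_integral_has_integral_lborel[OF assms])
  then show ?thesis using nn_integral_eq_integrable[of f lborel I] assms I by simp
qed

lemma power_majorant_integral:
  assumes "p > 0" "q > 0" "R > 0"
  shows "integrable lborel (power_majorant A p B q R)"
    and "integral\<^sup>L lborel (power_majorant A p B q R) = A * (R powr p / p) + B * (R powr (- q) / q)"
proof -
  have "((\<lambda>x. x powr (p - 1)) has_integral (R powr p / p)) {0..R}"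
    using has_integral_powr_from_0[of "p - 1" R] assms by simp
  then have "((\<lambda>x. if x \<in> {0..R} then x powr (p - 1) else 0) has_integral (R powr p / p)) UNIV"
    by (simp only: has_integral_restrict_UNIV)
  also have "(\<lambda>x. if x \<in> {0..R} then x powr (p - 1) else 0) = (\<lambda>x. indicator {0<..R} x * x powr (p - 1))"
    by (auto simp: indicator_def fun_eq_iff)
  finally have 1: "integrable lborel (\<lambda>x. indicator {0<..R} x * x powr (p - 1)) \<and>
      integral\<^sup>L lborel (\<lambda>x. indicator {0<..R} x * x powr (p - 1)) = R powr p / p"
    by (intro integral_of_nonneg_has_integral) auto
  have "((\<lambda>x. x powr (- q - 1)) has_integral (R powr (- q) / q)) {R..}"
    using has_integral_powr_to_inf[of "- q - 1" R] assms by simp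
  then have "((\<lambda>x. if x \<in> {R..} then x powr (- q - 1) else 0) has_integral (R powr (- q) / q)) UNIV"
    by (simp only: has_integral_restrict_UNIV)
  also have "(\<lambda>x. if x \<in> {R..} then x powr (- q - 1) else 0) = (\<lambda>x. indicator {R..} x * x powr (- q - 1))"
    by (auto simp: indicator_def fun_eq_iff)
  finally have 2: "integrable lborel (\<lambda>x. indicator {R..} x * x powr (- q - 1)) \<and>
      integral\<^sup>L lborel (\<lambda>x. indicator {R..} x * x powr (- q - 1)) = R powr (- q) / q"
    by (intro integral_of_nonneg_has_integral) auto
  show "integrable lborel (power_majorant A p B q R)"
    unfolding power_majorant_def [abs_def] using 1 2 by (intro Bochner_Integration.integrable_add integrable_mult_right) auto
  show "integral\<^sup>L lborel (power_majorant A p B q R) = A * (R powr p / p) + B * (R powr (- q) / q)"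
    unfolding power_majorant_def [abs_def] using 1 2
    by (subst Bochner_Integration.integral_add) auto
qed

lemma abs_le_power_majorant:
  assumes "A \<ge> 0" "B \<ge> 0"
    and "0 < \<tau> \<Longrightarrow> \<tau> \<le> R \<Longrightarrow> x \<le> A * \<tau> powr (p - 1)"
    and "R \<le> \<tau> \<Longrightarrow> x \<le> B * \<tau> powr (- q - 1)"
    and "\<tau> > 0"
  shows "x \<le> power_majorant A p B q R \<tau>"
proof (cases "\<tau> \<le> R")
  case True
  have "0 \<le> B * (indicator {R..} \<tau> * \<tau> powr (- q - 1))" using assms by auto
  moreover have "power_majorant A p B q R \<tau> = A * \<tau> powr (p - 1) + B * (indicator {R..} \<tau> * \<tau> powr (- q - 1))"
    using True assms(5) by (simp add: power_majorant_def)
  ultimately show ?thesis using assms(3)[OF assms(5) True] by linarith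
next
  case False
  then show ?thesis using assms by (simp add: power_majorant_def)
qed

lemma power_majorant_nonneg: "A \<ge> 0 \<Longrightarrow> B \<ge> 0 \<Longrightarrow> power_majorant A p B q R \<tau> \<ge> 0"
  by (simp add: power_majorant_def)

lemma integrable_dominated:
  fixes \<psi> h :: "real \<Rightarrow> real"
  assumes "integrable lborel h" "\<psi> \<in> borel_measurable borel" "\<And>x. \<bar>\<psi> x\<bar> \<le> h x"
  shows "integrable lborel \<psi>" "(\<integral>x. \<bar>\<psi> x\<bar> \<partial>lborel) \<le> integral\<^sup>L lborel h"
    "\<bar>integral\<^sup>L lborel \<psi>\<bar> \<le> integral\<^sup>L lborel h"
proof -
  show 1: "integrable lborel \<psi>"
    by (rule Bochner_Integration.integrable_bound[OF assms(1)])
      (use assms(2) order_trans[OF assms(3) abs_ge_self] in simp_all)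
  show 2: "(\<integral>x. \<bar>\<psi> x\<bar> \<partial>lborel) \<le> integral\<^sup>L lborel h"
    using 1 assms by (intro integral_mono) auto
  show "\<bar>integral\<^sup>L lborel \<psi>\<bar> \<le> integral\<^sup>L lborel h"
    using integral_abs_bound[of lborel \<psi>] 2 by linarith
qed

text \<open>
  Fubini for a series over the integers, reduced to series over the naturals by enumeration.
\<close>

lemma integral_infsum_int:
  fixes g :: "int \<Rightarrow> real \<Rightarrow> real"
  assumes int: "\<And>m. integrable lborel (g m)"
    and sum: "(\<lambda>m. \<integral>x. \<bar>g m x\<bar> \<partial>lborel) summable_on UNIV"
    and G: "\<And>x. ((\<lambda>m. g m x) has_sum G x) UNIV"
  shows "integrable lborel G" "((\<lambda>m. integral\<^sup>L lborel (g m)) has_sum integral\<^sup>L lborel G) UNIV"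
proof -
  let ?g = "\<lambda>i. g (int_decode i)"
  have reindex: "((\<lambda>i. u (int_decode i)) has_sum S) UNIV \<longleftrightarrow> (u has_sum S) UNIV" for u :: "int \<Rightarrow> real" and S
    by (rule has_sum_reindex_bij_betw[OF bij_int_decode])
  have abs: "summable (\<lambda>i. \<bar>u (int_decode i)\<bar>)" if "u summable_on UNIV" for u :: "int \<Rightarrow> real"
  proof -
    have "(\<lambda>m. norm (u m)) summable_on UNIV"
      using that summable_on_iff_abs_summable_on_real by blast
    then have "(\<lambda>i. norm (u (int_decode i))) summable_on UNIV"
      unfolding summable_on_def reindex[of "\<lambda>m. norm (u m)"] .
    then show ?thesis using summable_on_imp_summable by fastforce
  qed
  have 1: "AE x in lborel. summable (\<lambda>i. norm (?g i x))"
    using abs[OF has_sum_imp_summable[OF G]] by simp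
  have 2: "summable (\<lambda>i. \<integral>x. norm (?g i x) \<partial>lborel)"
    using abs[OF sum] by simp
  have Geq: "(\<Sum>i. ?g i x) = G x" for x
  proof -
    have "((\<lambda>i. ?g i x) has_sum G x) UNIV"
      unfolding reindex[of "\<lambda>m. g m x"] by (rule G)
    then show ?thesis by (intro sums_unique[symmetric] has_sum_imp_sums)
  qed
  show "integrable lborel G"
    using integrable_suminf[OF int 1 2] unfolding Geq .
  have s: "(\<lambda>i. integral\<^sup>L lborel (?g i)) sums integral\<^sup>L lborel G"
    using sums_integral[OF int 1 2] unfolding Geq .
  have "summable (\<lambda>i. norm (integral\<^sup>L lborel (?g i)))"
    by (rule summable_comparison_test'[OF 2, of 0]) (simp add: integral_abs_bound)
  then have "((\<lambda>i. integral\<^sup>L lborel (?g i)) has_sum integral\<^sup>L lborel G) UNIV"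
    using s by (rule norm_summable_imp_has_sum)
  then show "((\<lambda>m. integral\<^sup>L lborel (g m)) has_sum integral\<^sup>L lborel G) UNIV"
    unfolding reindex[of "\<lambda>m. integral\<^sup>L lborel (g m)"] .
qed

lemma borel_heat_semigroup:
  assumes "exp_growth f"
  shows "(\<lambda>t. heat_semigroup t f n) \<in> borel_measurable borel"
  by (intro borel_measurable_continuous_onI continuous_heat_semigroup assms)

lemma borel_heat_kernel: "(\<lambda>t. heat_kernel t n) \<in> borel_measurable borel"
proof -
  let ?\<delta> = "\<lambda>j::int. if j = 0 then 1 else 0 :: real"
  have \<delta>: "exp_growth ?\<delta>" by (rule exp_growthI[of _ 1 0]) simp
  have "heat_semigroup t ?\<delta> n = heat_kernel t n" for t
  proof -
    have "((\<lambda>j. heat_kernel t (n - j) * ?\<delta> j) has_sum heat_kernel t n) UNIV"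
      by (rule has_sum_finite_neutralI[of "{0}"]) auto
    then show ?thesis using heat_kernel_has_sum[OF \<delta>] has_sum_unique by blast
  qed
  then show ?thesis using borel_heat_semigroup[OF \<delta>, of n] by simp
qed

section \<open>Large times and the weighted summability condition\<close>

text \<open>
  For \<open>\<tau> \<ge> 1 + n\<^sup>2\<close> moving the centre from \<open>n\<close> to \<open>0\<close> costs a constant factor only, so the bound
  depends on \<open>n\<close> through the range of \<open>\<tau>\<close> alone.
\<close>

lemma heat_kernel_far_bound:
  assumes i: "1 \<le> i" "i \<le> K" and \<tau>: "\<tau> \<ge> 1 + (real_of_int n)\<^sup>2"
  shows "\<bar>heat_kernel (real i * \<tau>) (n - m)\<bar>
    \<le> exp 2 * (\<tau> powr (- (1 / 2)) * exp (- ((1 + \<bar>real_of_int m\<bar>) / (2 * real K * sqrt \<tau>))))"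
proof -
  define t where "t = real i * \<tau>"
  have \<tau>1: "\<tau> \<ge> 1" by (rule order_trans[OF _ \<tau>]) simp
  have n\<tau>: "(real_of_int n)\<^sup>2 \<le> \<tau>" by (rule order_trans[OF _ \<tau>]) simp
  have t\<tau>: "\<tau> \<le> t" unfolding t_def using i \<tau>1 by (simp add: mult_le_cancel_right1)
  have t1: "t \<ge> 1" using t\<tau> \<tau>1 by simp
  have s: "sqrt \<tau> \<le> sqrt t" using t\<tau> by simp
  have s1: "sqrt \<tau> \<ge> 1" using \<tau>1 by simp
  have sK: "sqrt t \<le> real K * sqrt \<tau>"
  proof -
    have "real i \<le> (real K)\<^sup>2"
    proof -
      have "i \<le> K * K" using i by (metis le_trans le_square)
      then show ?thesis by (simp add: power2_eq_square flip: of_nat_mult)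
    qed
    then have "t \<le> (real K)\<^sup>2 * \<tau>" unfolding t_def using \<tau>1 by (intro mult_right_mono) auto
    then have "sqrt t \<le> sqrt ((real K)\<^sup>2 * \<tau>)" by simp
    then show ?thesis by (simp add: real_sqrt_mult)
  qed
  let ?y = "1 + \<bar>real_of_int m\<bar>"
  have n: "(1 + \<bar>real_of_int n\<bar>) / (2 * sqrt t) \<le> 1"
  proof -
    have "\<bar>real_of_int n\<bar> \<le> sqrt \<tau>" using n\<tau> by (simp add: real_le_rsqrt)
    then have "1 + \<bar>real_of_int n\<bar> \<le> 2 * sqrt t" using s s1 by linarith
    moreover have "2 * sqrt t > 0" using t1 by simp
    ultimately show ?thesis by (simp only: divide_le_eq_1_pos)
  qed
  have "?y / (2 * real K * sqrt \<tau>) \<le> ?y / (2 * sqrt t)"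
  proof (rule divide_left_mono)
    have "real K > 0" "sqrt \<tau> > 0" "sqrt t > 0" using i \<tau>1 t1 by auto
    then show "0 < (2 * real K * sqrt \<tau>) * (2 * sqrt t)" by (intro mult_pos_pos) auto
  qed (use sK in auto)
  also have "\<dots> \<le> (\<bar>real_of_int (n - m)\<bar> + (1 + \<bar>real_of_int n\<bar>)) / (2 * sqrt t)"
    using s1 s by (intro divide_right_mono) auto
  also have "\<dots> \<le> \<bar>real_of_int (n - m)\<bar> / (2 * sqrt t) + 1"
    using n by (simp add: add_divide_distrib)
  finally have e: "- (\<bar>real_of_int (n - m)\<bar> / (2 * sqrt t)) \<le> 1 + - (?y / (2 * real K * sqrt \<tau>))" by simp
  have "\<bar>heat_kernel t (n - m)\<bar> \<le> exp 1 / sqrt t * exp (- (\<bar>real_of_int (n - m)\<bar> / (2 * sqrt t)))"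
    by (rule heat_kernel_exponential_bound[OF t1])
  also have "\<dots> \<le> exp 1 / sqrt \<tau> * exp (1 + - (?y / (2 * real K * sqrt \<tau>)))"
    using e s s1 by (intro mult_mono divide_left_mono iffD2[OF exp_le_cancel_iff]) auto
  also have "\<dots> = (exp 1 * exp 1) * (1 / sqrt \<tau> * exp (- (?y / (2 * real K * sqrt \<tau>))))"
    by (simp only: exp_add) (simp add: mult_ac)
  also have "exp 1 * exp 1 = (exp 2 :: real)" using exp_add[of 1 "1 :: real"] by simp
  also have "1 / sqrt \<tau> = \<tau> powr (- (1 / 2))"
    unfolding powr_minus using \<tau>1 by (simp add: powr_half_sqrt inverse_eq_divide)
  finally show ?thesis unfolding t_def .
qed

text \<open>
  Up to \<open>\<tau> = y\<^sup>2\<close> the exponential is at most a multiple of \<open>(sqrt \<tau> / y) powr p\<close>, and \<open>p = 3 + 2 * \<beta>\<close>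
  cancels all powers of \<open>\<tau>\<close>; beyond \<open>y\<^sup>2\<close> it is at most \<open>1\<close>.
\<close>

lemma kernel_time_integral:
  assumes "\<beta> > 0" "K \<ge> 1"
  shows "\<exists>C\<ge>0. \<forall>y\<ge>1. \<exists>h. integrable lborel h \<and> (\<forall>\<tau>. 0 \<le> h \<tau>) \<and>
    integral\<^sup>L lborel h = C * y powr (- (1 + 2 * \<beta>)) \<and>
    (\<forall>\<tau>>0. \<tau> powr (- (1 / 2)) * exp (- (y / (2 * real K * sqrt \<tau>))) / \<tau> powr (1 + \<beta>) \<le> h \<tau>)"
proof -
  define p where "p = 3 + 2 * \<beta>"
  have p: "p > 0" using assms by (simp add: p_def)
  define D where "D = p powr p * (2 * real K) powr p"
  define C where "C = D + 1 / (1 / 2 + \<beta>)"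
  have main: "\<exists>h. integrable lborel h \<and> (\<forall>\<tau>. 0 \<le> h \<tau>) \<and>
    integral\<^sup>L lborel h = C * y powr (- (1 + 2 * \<beta>)) \<and>
    (\<forall>\<tau>>0. \<tau> powr (- (1 / 2)) * exp (- (y / (2 * real K * sqrt \<tau>))) / \<tau> powr (1 + \<beta>) \<le> h \<tau>)"
    if y: "y \<ge> 1" for y :: real
  proof -
    let ?h = "power_majorant (D * y powr (- p)) 1 1 (1 / 2 + \<beta>) (y\<^sup>2)"
    have y2: "y\<^sup>2 = y powr 2" using y by simp
    have int: "integral\<^sup>L lborel ?h = C * y powr (- (1 + 2 * \<beta>))"
    proof -
      have "integral\<^sup>L lborel ?h = D * y powr (- p) * ((y\<^sup>2) powr 1 / 1) + 1 * ((y\<^sup>2) powr (- (1 / 2 + \<beta>)) / (1 / 2 + \<beta>))"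
        using assms y by (intro power_majorant_integral) auto
      also have "(y\<^sup>2) powr (- (1 / 2 + \<beta>)) = y powr (- (1 + 2 * \<beta>))"
        unfolding y2 powr_powr by (rule arg_cong[of _ _ "(powr) y"]) (simp add: algebra_simps)
      also have "D * y powr (- p) * ((y\<^sup>2) powr 1 / 1) = D * y powr (- (1 + 2 * \<beta>))"
      proof -
        have "y powr (- p) * y powr 2 = y powr (- (1 + 2 * \<beta>))"
          unfolding powr_add[symmetric] by (rule arg_cong[of _ _ "(powr) y"]) (simp add: p_def)
        then show ?thesis unfolding y2 powr_powr by (simp add: mult.assoc)
      qed
      finally show ?thesis by (simp add: C_def algebra_simps)
    qed
    have le: "\<tau> powr (- (1 / 2)) * exp (- (y / (2 * real K * sqrt \<tau>))) / \<tau> powr (1 + \<beta>) \<le> ?h \<tau>"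
      if \<tau>: "\<tau> > 0" for \<tau>
    proof (rule abs_le_power_majorant[OF _ _ _ _ \<tau>])
      let ?z = "y / (2 * real K * sqrt \<tau>)"
      have z: "?z > 0" using y \<tau> assms by simp
      have zp: "?z powr p = y powr p / ((2 * real K) powr p * \<tau> powr (3 / 2 + \<beta>))"
      proof -
        have "sqrt \<tau> powr p = \<tau> powr (3 / 2 + \<beta>)"
          using \<tau> by (simp add: powr_half_sqrt[symmetric] powr_powr p_def field_simps)
        then show ?thesis using y \<tau> by (simp add: powr_divide powr_mult)
      qed
      have "exp (- ?z) \<le> p powr p / ?z powr p"
      proof -
        have "exp (- ?z) * ?z powr p \<le> exp (- ?z) * (p powr p * exp ?z)"
          using z p by (intro mult_left_mono powr_le_exp) auto
        also have "\<dots> = p powr p" by (simp add: exp_minus)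
        finally show ?thesis using z assms(2) by (subst pos_le_divide_eq) auto
      qed
      also have "\<dots> = D * y powr (- p) * \<tau> powr (3 / 2 + \<beta>)"
      proof -
        have "P / (Y / (k * T)) = P * k * inverse Y * T" for P Y k T :: real
          by (simp add: divide_inverse mult_ac)
        then show ?thesis unfolding zp D_def powr_minus .
      qed
      finally have "\<tau> powr (- (1 / 2)) * exp (- ?z) / \<tau> powr (1 + \<beta>)
          \<le> \<tau> powr (- (1 / 2)) * (D * y powr (- p) * \<tau> powr (3 / 2 + \<beta>)) / \<tau> powr (1 + \<beta>)"
        by (intro divide_right_mono mult_left_mono) auto
      also have "\<dots> = D * y powr (- p) * (\<tau> powr (- (1 / 2)) * \<tau> powr (3 / 2 + \<beta>) / \<tau> powr (1 + \<beta>))" by simp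
      also have "\<tau> powr (- (1 / 2)) * \<tau> powr (3 / 2 + \<beta>) / \<tau> powr (1 + \<beta>) = \<tau> powr (1 - 1)"
        by (simp flip: powr_add powr_diff)
      finally show "\<tau> powr (- (1 / 2)) * exp (- ?z) / \<tau> powr (1 + \<beta>) \<le> D * y powr (- p) * \<tau> powr (1 - 1)" .
      have "\<tau> powr (- (1 / 2)) * exp (- ?z) / \<tau> powr (1 + \<beta>) \<le> \<tau> powr (- (1 / 2)) * 1 / \<tau> powr (1 + \<beta>)"
        using z by (intro divide_right_mono mult_left_mono) auto
      also have "\<dots> = 1 * \<tau> powr (- (1 / 2 + \<beta>) - 1)"
      proof -
        have "- (1 / 2) - (1 + \<beta>) = - (1 / 2 + \<beta>) - 1" by simp
        then show ?thesis by (metis mult.right_neutral mult_1 powr_diff)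
      qed
      finally show "\<tau> powr (- (1 / 2)) * exp (- ?z) / \<tau> powr (1 + \<beta>) \<le> 1 * \<tau> powr (- (1 / 2 + \<beta>) - 1)" .
    qed (auto simp: D_def)
    have "integrable lborel ?h" using assms y by (intro power_majorant_integral) auto
    moreover have "0 \<le> ?h \<tau>" for \<tau> by (intro power_majorant_nonneg) (auto simp: D_def)
    ultimately show ?thesis using int le by blast
  qed
  have "C \<ge> 0" unfolding C_def D_def using assms by auto
  with main show ?thesis by blast
qed

text \<open>
  This is where membership in \<^const>\<open>ell_space\<close> enters: the time integral of the kernel has exactly the
  decay of the weight, uniformly in \<open>n\<close>.
\<close>

theorem heat_tail_integral:
  assumes "\<beta> > 0" "u \<in> ell_space \<beta>" "exp_growth u"
  shows "\<exists>C\<ge>0. \<forall>n. \<forall>i\<in>{1..K}.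
    integrable lborel (\<lambda>\<tau>. indicator {1 + (real_of_int n)\<^sup>2..} \<tau> / \<tau> powr (1 + \<beta>) * heat_semigroup (real i * \<tau>) (\<lambda>m. \<bar>u m\<bar>) n) \<and>
    (\<integral>\<tau>. indicator {1 + (real_of_int n)\<^sup>2..} \<tau> / \<tau> powr (1 + \<beta>) * heat_semigroup (real i * \<tau>) (\<lambda>m. \<bar>u m\<bar>) n \<partial>lborel) \<le> C"
proof (cases "K \<ge> 1")
  case K: True
  obtain C where C: "C \<ge> 0" "\<And>y. y \<ge> 1 \<Longrightarrow> \<exists>h. integrable lborel h \<and> (\<forall>\<tau>. 0 \<le> h \<tau>) \<and>
    integral\<^sup>L lborel h = C * y powr (- (1 + 2 * \<beta>)) \<and>
    (\<forall>\<tau>>0. \<tau> powr (- (1 / 2)) * exp (- (y / (2 * real K * sqrt \<tau>))) / \<tau> powr (1 + \<beta>) \<le> h \<tau>)"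
    using kernel_time_integral[OF assms(1) K] by blast
  let ?y = "\<lambda>m::int. 1 + \<bar>real_of_int m\<bar>"
  define b where "b = (\<lambda>m::int. exp 2 * C * (\<bar>u m\<bar> / ?y m powr (1 + 2 * \<beta>)))"
  have b: "b summable_on UNIV"
    using assms(2) unfolding b_def ell_space_def by (intro summable_on_cmult_right) auto
  have b0: "b m \<ge> 0" for m unfolding b_def using C(1) by auto
  have main: "integrable lborel (\<lambda>\<tau>. indicator {1 + (real_of_int n)\<^sup>2..} \<tau> / \<tau> powr (1 + \<beta>) * heat_semigroup (real i * \<tau>) (\<lambda>m. \<bar>u m\<bar>) n) \<and>
    (\<integral>\<tau>. indicator {1 + (real_of_int n)\<^sup>2..} \<tau> / \<tau> powr (1 + \<beta>) * heat_semigroup (real i * \<tau>) (\<lambda>m. \<bar>u m\<bar>) n \<partial>lborel) \<le> infsum b UNIV"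
    if i: "i \<in> {1..K}" for n i
  proof -
    let ?R = "1 + (real_of_int n)\<^sup>2"
    define g where "g = (\<lambda>m \<tau>. indicator {?R..} \<tau> / \<tau> powr (1 + \<beta>) * (heat_kernel (real i * \<tau>) (n - m) * \<bar>u m\<bar>))"
    have gm: "integrable lborel (g m) \<and> (\<integral>x. \<bar>g m x\<bar> \<partial>lborel) \<le> b m" for m
    proof -
      obtain h where h: "integrable lborel h" "\<And>\<tau>. 0 \<le> h \<tau>"
        "integral\<^sup>L lborel h = C * ?y m powr (- (1 + 2 * \<beta>))"
        "\<And>\<tau>. \<tau> > 0 \<Longrightarrow> \<tau> powr (- (1 / 2)) * exp (- (?y m / (2 * real K * sqrt \<tau>))) / \<tau> powr (1 + \<beta>) \<le> h \<tau>"
        using C(2)[of "?y m"] by auto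
      have int: "integrable lborel (\<lambda>\<tau>. (exp 2 * \<bar>u m\<bar>) * h \<tau>)" using h(1) by simp
      have meas: "g m \<in> borel_measurable borel"
      proof -
        have "(\<lambda>\<tau>. heat_kernel (real i * \<tau>) (n - m)) \<in> borel_measurable borel"
          using measurable_compose[OF _ borel_heat_kernel, of "\<lambda>\<tau>. real i * \<tau>"] by simp
        then show ?thesis unfolding g_def by measurable
      qed
      have bd: "\<bar>g m \<tau>\<bar> \<le> (exp 2 * \<bar>u m\<bar>) * h \<tau>" for \<tau>
      proof (cases "\<tau> \<ge> ?R")
        case True
        have "0 \<le> (real_of_int n)\<^sup>2" by simp
        with True have \<tau>: "\<tau> > 0" by linarith
        have "\<bar>g m \<tau>\<bar> = 1 / \<tau> powr (1 + \<beta>) * (\<bar>heat_kernel (real i * \<tau>) (n - m)\<bar> * \<bar>u m\<bar>)"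
          using True by (simp add: g_def abs_mult)
        also have "\<dots> \<le> 1 / \<tau> powr (1 + \<beta>) * ((exp 2 * (\<tau> powr (- (1 / 2)) * exp (- (?y m / (2 * real K * sqrt \<tau>))))) * \<bar>u m\<bar>)"
          using i True by (intro mult_left_mono mult_right_mono heat_kernel_far_bound) auto
        also have "\<dots> = (exp 2 * \<bar>u m\<bar>) * (\<tau> powr (- (1 / 2)) * exp (- (?y m / (2 * real K * sqrt \<tau>))) / \<tau> powr (1 + \<beta>))"
          by simp
        also have "\<dots> \<le> (exp 2 * \<bar>u m\<bar>) * h \<tau>" using h(4)[OF \<tau>] by (intro mult_left_mono) auto
        finally show ?thesis .
      qed (use h(2) in \<open>simp add: g_def\<close>)
      have "(\<integral>x. \<bar>g m x\<bar> \<partial>lborel) \<le> integral\<^sup>L lborel (\<lambda>\<tau>. (exp 2 * \<bar>u m\<bar>) * h \<tau>)"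
        by (rule integrable_dominated(2)[OF int meas bd])
      also have "\<dots> = b m" unfolding b_def integral_mult_right_zero h(3) powr_minus divide_inverse by (simp add: mult_ac)
      finally show ?thesis using integrable_dominated(1)[OF int meas bd] by blast
    qed
    have sm: "(\<lambda>m. \<integral>x. \<bar>g m x\<bar> \<partial>lborel) summable_on UNIV"
      by (rule summable_on_comparison_test[OF b]) (use gm in auto)
    have G: "((\<lambda>m. g m \<tau>) has_sum (indicator {?R..} \<tau> / \<tau> powr (1 + \<beta>) * heat_semigroup (real i * \<tau>) (\<lambda>m. \<bar>u m\<bar>) n)) UNIV" for \<tau>
      unfolding g_def by (intro has_sum_cmult_right heat_kernel_has_sum exp_growth_abs assms)
    note I = integral_infsum_int[OF conjunct1[OF gm] sm G]
    have "integral\<^sup>L lborel (g m) \<le> b m" for m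
      using integral_abs_bound[of lborel "g m"] gm[of m] by linarith
    then show ?thesis using I(1) has_sum_mono[OF I(2) has_sum_infsum[OF b]] by simp
  qed
  have "infsum b UNIV \<ge> 0" using b0 by (simp add: infsum_nonneg)
  with main show ?thesis by blast
qed auto

section \<open>The fractional Laplacian\<close>

lemma laplacian_pow_integral:
  fixes \<psi> :: "int \<Rightarrow> real \<Rightarrow> real"
  assumes "\<And>m. integrable lborel (\<psi> m)"
  shows "integrable lborel (\<lambda>\<tau>. (discrete_laplacian ^^ j) (\<lambda>m. \<psi> m \<tau>) n) \<and>
    (discrete_laplacian ^^ j) (\<lambda>m. integral\<^sup>L lborel (\<psi> m)) n
      = (\<integral>\<tau>. (discrete_laplacian ^^ j) (\<lambda>m. \<psi> m \<tau>) n \<partial>lborel)"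
proof (induction j arbitrary: n)
  case (Suc j)
  then have "integrable lborel (\<lambda>\<tau>. (discrete_laplacian ^^ j) (\<lambda>m. \<psi> m \<tau>) n)" for n by blast
  with Suc show ?case by (simp add: discrete_laplacian_def [of "(discrete_laplacian ^^ j) _"])
qed (use assms in auto)

lemma laplacian_pow_cmult:
  "(discrete_laplacian ^^ j) (\<lambda>m. c * g m) n = c * (discrete_laplacian ^^ j) g n"
  by (induction j arbitrary: n) (simp_all add: discrete_laplacian_def [of "(discrete_laplacian ^^ _) _"] algebra_simps)

lemma powr_divide_powr: "x powr a / x powr (1 + b) = x powr (a - b - 1)" for x :: real
  unfolding powr_diff[symmetric] by (rule arg_cong[of _ _ "(powr) x"]) simp

text \<open>
  The time axis is cut at \<open>R = 1 + n\<^sup>2\<close>.  Below, the local derivative bounds make the \<open>K\<close>-fold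
  difference of size \<open>\<tau> powr \<gamma>\<close> with \<open>\<gamma> > \<beta>\<close>.  Above, the difference is expanded into its terms: the
  one without heat flow is \<open>f n\<close> itself, and the others are tail integrals bounded uniformly in \<open>n\<close>.
\<close>

lemma frac_integrand_local_bound:
  assumes "\<beta> > 0" "2 * \<beta> < \<alpha>" "f \<in> Lambda_H \<alpha>" "f \<in> ell_space \<beta>"
  shows "\<exists>C\<ge>0. \<forall>n. integrable lborel (\<lambda>\<tau>. indicator {0<..} \<tau> * frac_integrand \<beta> f n \<tau>) \<and>
    (\<integral>\<tau>. \<bar>indicator {0<..} \<tau> * frac_integrand \<beta> f n \<tau>\<bar> \<partial>lborel) \<le> C * (1 + (real_of_int n)\<^sup>2) powr (\<alpha> / 2 - \<beta>)"
proof -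
  define K where "K = nat \<lfloor>\<beta>\<rfloor> + 1"
  have integrand: "frac_integrand \<beta> f n \<tau> = (heat_difference \<tau> ^^ K) f n / \<tau> powr (1 + \<beta>)" for n \<tau>
    unfolding frac_integrand_def K_def ..
  have K: "\<beta> < real K" "K \<ge> 1" using assms(1) unfolding K_def by linarith+
  have \<alpha>: "\<alpha> > 0" using assms by simp
  define R where "R = (\<lambda>n::int. 1 + (real_of_int n)\<^sup>2)"
  have R1: "R n \<ge> 1" for n unfolding R_def by simp
  (* Above \<beta> for convergence at 0, at most \<alpha>/2 and below K for the local bound. *)
  define \<gamma> where "\<gamma> = (\<beta> + min (\<alpha> / 2) (real K)) / 2"
  have \<gamma>: "\<beta> < \<gamma>" "\<gamma> \<le> \<alpha> / 2" "\<gamma> < real K"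
    using assms(2) K(1) by (auto simp: \<gamma>_def min_def)
  have pg: "poly_growth \<alpha> f" using assms(3) Lambda_H_iff[OF \<alpha>] by blast
  have f: "exp_growth f" by (rule poly_growth_imp_exp_growth[OF pg \<alpha>])
  obtain c :: "nat \<Rightarrow> real" where
    c: "\<And>\<tau> w t. (step_difference \<tau> ^^ K) w t = (\<Sum>i\<le>K. c i * w (t + real i * \<tau>))"
    using step_difference_pow_sum[of K] by blast
  have formula: "(heat_difference \<tau> ^^ K) f n = (\<Sum>i\<le>K. c i * heat_semigroup (real i * \<tau>) f n)"
    if "\<tau> \<ge> 0" for \<tau> n
    using heat_difference_pow_eq[OF f that] c by simp
  obtain C1 where C1: "C1 \<ge> 0" "\<And>n s. 0 < s \<Longrightarrow> s \<le> real K * R n \<Longrightarrow>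
    \<bar>heat_semigroup s ((discrete_laplacian ^^ K) f) n\<bar> \<le> C1 * (real K * R n) powr (\<alpha> / 2 - \<gamma>) * s powr (\<gamma> - real K)"
    using Lambda_H_heat_laplacian_bound_local[OF \<alpha> assms(3) _ \<gamma>(2,3), of "real K"] K(2)
    unfolding R_def by auto
  obtain C2 where C2: "C2 \<ge> 0" "\<And>n i. i \<in> {1..K} \<Longrightarrow>
    integrable lborel (\<lambda>\<tau>. indicator {R n..} \<tau> / \<tau> powr (1 + \<beta>) * heat_semigroup (real i * \<tau>) (\<lambda>m. \<bar>f m\<bar>) n) \<and>
    (\<integral>\<tau>. indicator {R n..} \<tau> / \<tau> powr (1 + \<beta>) * heat_semigroup (real i * \<tau>) (\<lambda>m. \<bar>f m\<bar>) n \<partial>lborel) \<le> C2"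
    using heat_tail_integral[OF assms(1,4) f, of K] unfolding R_def by blast
  obtain A where A: "A \<ge> 0" "\<And>n. \<bar>f n\<bar> \<le> A * (1 + \<bar>real_of_int n\<bar> powr \<alpha>)"
    using poly_growthE[OF pg] by blast
  define M where "M = C1 * real K powr (\<alpha> / 2 - \<gamma>) * (real K / \<gamma>) ^ K"
  have M: "M \<ge> 0" unfolding M_def using C1 \<gamma> assms(1) by (intro mult_nonneg_nonneg) auto
  define C where "C = M / (\<gamma> - \<beta>) + \<bar>c 0\<bar> * (2 * A) / \<beta> + (\<Sum>i=1..K. \<bar>c i\<bar> * C2)"
  have C: "C \<ge> 0"
    unfolding C_def using M A C2 assms(1) \<gamma> by (intro add_nonneg_nonneg sum_nonneg divide_nonneg_nonneg mult_nonneg_nonneg) auto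
  have fR: "\<bar>f n\<bar> \<le> 2 * A * R n powr (\<alpha> / 2)" for n
  proof -
    have "\<bar>real_of_int n\<bar> powr \<alpha> \<le> R n powr (\<alpha> / 2)"
    proof -
      have "\<bar>real_of_int n\<bar> \<le> R n powr (1 / 2)"
        using R1[of n] by (simp add: powr_half_sqrt R_def real_le_rsqrt)
      then have "\<bar>real_of_int n\<bar> powr \<alpha> \<le> (R n powr (1 / 2)) powr \<alpha>" using \<alpha> by (intro powr_mono2) auto
      then show ?thesis by (simp add: powr_powr)
    qed
    moreover have "1 \<le> R n powr (\<alpha> / 2)" using R1 \<alpha> by (simp add: ge_one_powr_ge_zero)
    ultimately have "1 + \<bar>real_of_int n\<bar> powr \<alpha> \<le> 2 * R n powr (\<alpha> / 2)" by linarith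
    from mult_left_mono[OF this A(1)] A(2)[of n] show ?thesis by simp
  qed
  have main: "integrable lborel (\<lambda>\<tau>. indicator {0<..} \<tau> * frac_integrand \<beta> f n \<tau>) \<and>
    (\<integral>\<tau>. \<bar>indicator {0<..} \<tau> * frac_integrand \<beta> f n \<tau>\<bar> \<partial>lborel) \<le> C * R n powr (\<alpha> / 2 - \<beta>)" for n
  proof -
    let ?\<psi> = "\<lambda>\<tau>. indicator {0<..} \<tau> * frac_integrand \<beta> f n \<tau>"
    define L where "L = (\<lambda>i \<tau>. indicator {R n..} \<tau> / \<tau> powr (1 + \<beta>) * heat_semigroup (real i * \<tau>) (\<lambda>m. \<bar>f m\<bar>) n)"
    have Lint: "integrable lborel (L i)" "integral\<^sup>L lborel (L i) \<le> C2" if "i \<in> {1..K}" for i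
      using C2(2)[OF that] unfolding L_def by auto
    have L0: "L i \<tau> \<ge> 0" for i \<tau>
    proof (cases "\<tau> \<ge> R n")
      case True
      then have "\<tau> \<ge> 0" using R1[of n] by linarith
      then have "\<bar>heat_semigroup (real i * \<tau>) f n\<bar> \<le> heat_semigroup (real i * \<tau>) (\<lambda>m. \<bar>f m\<bar>) n"
        by (intro heat_semigroup_abs_le f) auto
      then show ?thesis by (simp add: L_def)
    qed (simp add: L_def)
    let ?A = "M * R n powr (\<alpha> / 2 - \<gamma>)" and ?B = "\<bar>c 0\<bar> * \<bar>f n\<bar>"
    let ?P = "power_majorant ?A (\<gamma> - \<beta>) ?B \<beta> (R n)"
    define h where "h = (\<lambda>\<tau>. ?P \<tau> + (\<Sum>i=1..K. \<bar>c i\<bar> * L i \<tau>))"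
    have P: "integrable lborel ?P"
      "integral\<^sup>L lborel ?P = ?A * (R n powr (\<gamma> - \<beta>) / (\<gamma> - \<beta>)) + ?B * (R n powr (- \<beta>) / \<beta>)"
      using power_majorant_integral[of "\<gamma> - \<beta>" \<beta> "R n"] \<gamma> assms(1) R1[of n] by auto
    have h: "integrable lborel h"
      unfolding h_def using Lint(1)
      by (intro Bochner_Integration.integrable_add P(1) Bochner_Integration.integrable_sum integrable_mult_right) auto
    have "integral\<^sup>L lborel h = integral\<^sup>L lborel ?P + (\<Sum>i=1..K. \<bar>c i\<bar> * integral\<^sup>L lborel (L i))"
      unfolding h_def using Lint(1) P(1)
      by (subst Bochner_Integration.integral_add) (auto intro!: Bochner_Integration.integrable_sum)
    also have "\<dots> \<le> C * R n powr (\<alpha> / 2 - \<beta>)"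
    proof -
      have 1: "?A * (R n powr (\<gamma> - \<beta>) / (\<gamma> - \<beta>)) = M / (\<gamma> - \<beta>) * R n powr (\<alpha> / 2 - \<beta>)"
      proof -
        have "R n powr (\<alpha> / 2 - \<gamma>) * R n powr (\<gamma> - \<beta>) = R n powr (\<alpha> / 2 - \<beta>)"
          by (simp flip: powr_add)
        then show ?thesis by simp
      qed
      have "?B * (R n powr (- \<beta>) / \<beta>) \<le> (\<bar>c 0\<bar> * (2 * A * R n powr (\<alpha> / 2))) * (R n powr (- \<beta>) / \<beta>)"
        using fR[of n] assms(1) by (intro mult_right_mono mult_left_mono) auto
      also have "\<dots> = \<bar>c 0\<bar> * (2 * A) / \<beta> * (R n powr (\<alpha> / 2) * R n powr (- \<beta>))" by simp
      also have "R n powr (\<alpha> / 2) * R n powr (- \<beta>) = R n powr (\<alpha> / 2 - \<beta>)" by (simp flip: powr_add)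
      finally have 2: "?B * (R n powr (- \<beta>) / \<beta>) \<le> \<bar>c 0\<bar> * (2 * A) / \<beta> * R n powr (\<alpha> / 2 - \<beta>)" .
      have "(\<Sum>i=1..K. \<bar>c i\<bar> * integral\<^sup>L lborel (L i)) \<le> (\<Sum>i=1..K. \<bar>c i\<bar> * C2)"
        using Lint(2) by (intro sum_mono mult_left_mono) auto
      also have "\<dots> \<le> (\<Sum>i=1..K. \<bar>c i\<bar> * C2) * R n powr (\<alpha> / 2 - \<beta>)"
      proof -
        have "0 \<le> (\<Sum>i=1..K. \<bar>c i\<bar> * C2)" using C2(1) by (intro sum_nonneg) auto
        moreover have "1 \<le> R n powr (\<alpha> / 2 - \<beta>)" using R1 assms(2) by (intro ge_one_powr_ge_zero) auto
        ultimately show ?thesis by (simp add: mult_le_cancel_left1)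
      qed
      finally show ?thesis unfolding P(2) 1 C_def distrib_right using 2 by linarith
    qed
    finally have hC: "integral\<^sup>L lborel h \<le> C * R n powr (\<alpha> / 2 - \<beta>)" .
    have meas: "?\<psi> \<in> borel_measurable borel"
    proof -
      have [measurable]: "(\<lambda>\<tau>. heat_semigroup (real i * \<tau>) f n) \<in> borel_measurable borel" for i
        using measurable_compose[OF _ borel_heat_semigroup[OF f], of "\<lambda>\<tau>. real i * \<tau>"] by simp
      have "?\<psi> = (\<lambda>\<tau>. indicator {0<..} \<tau> * ((\<Sum>i\<le>K. c i * heat_semigroup (real i * \<tau>) f n) / \<tau> powr (1 + \<beta>)))"
        by (rule ext) (auto simp: indicator_def integrand formula)
      also have "\<dots> \<in> borel_measurable borel" by measurable
      finally show ?thesis .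
    qed
    have bd: "\<bar>?\<psi> \<tau>\<bar> \<le> h \<tau>" for \<tau>
    proof (cases "\<tau> > 0")
      case True
      let ?D = "(heat_difference \<tau> ^^ K) f n"
      have \<psi>: "\<bar>?\<psi> \<tau>\<bar> = \<bar>?D\<bar> / \<tau> powr (1 + \<beta>)"
        using True by (simp add: integrand abs_divide)
      have S0: "(\<Sum>i=1..K. \<bar>c i\<bar> * L i \<tau>) \<ge> 0" by (intro sum_nonneg mult_nonneg_nonneg L0) auto
      have "\<bar>?D\<bar> / \<tau> powr (1 + \<beta>) - (\<Sum>i=1..K. \<bar>c i\<bar> * L i \<tau>) \<le> ?P \<tau>"
      proof (rule abs_le_power_majorant[OF _ _ _ _ True])
        assume \<tau>: "0 < \<tau>" "\<tau> \<le> R n"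
        have "\<bar>?D\<bar> \<le> (C1 * (real K * R n) powr (\<alpha> / 2 - \<gamma>)) * (real K / \<gamma>) ^ K * \<tau> powr \<gamma>"
          unfolding heat_difference_pow_eq[OF f less_imp_le[OF True]]
        proof (rule iterated_step_difference_bound[where w = "\<lambda>i s. heat_semigroup s ((discrete_laplacian ^^ i) f) n", simplified funpow_0])
          show "((\<lambda>s. heat_semigroup s ((discrete_laplacian ^^ i) f) n) has_real_derivative
              heat_semigroup s ((discrete_laplacian ^^ Suc i) f) n) (at s)" for i s
            using heat_equation[OF exp_growth_laplacian_pow[OF f]] by simp
          show "\<bar>heat_semigroup (0 + s) ((discrete_laplacian ^^ K) f) n\<bar>
              \<le> C1 * (real K * R n) powr (\<alpha> / 2 - \<gamma>) * s powr (\<gamma> - real K)"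
            if "0 < s" "s \<le> real K * \<tau>" for s
          proof -
            have "real K * \<tau> \<le> real K * R n" using \<tau> by (intro mult_left_mono) auto
            then show ?thesis using C1(2)[of s n] that by simp
          qed
        qed (use \<gamma> assms(1) C1(1) True in auto)
        also have "\<dots> = ?A * \<tau> powr \<gamma>" using R1[of n] by (simp add: M_def powr_mult)
        finally have "\<bar>?D\<bar> / \<tau> powr (1 + \<beta>) \<le> ?A * \<tau> powr \<gamma> / \<tau> powr (1 + \<beta>)"
          by (intro divide_right_mono) auto
        also have "\<dots> = ?A * \<tau> powr (\<gamma> - \<beta> - 1)"
          by (simp flip: powr_divide_powr)
        finally show "\<bar>?D\<bar> / \<tau> powr (1 + \<beta>) - (\<Sum>i=1..K. \<bar>c i\<bar> * L i \<tau>) \<le> ?A * \<tau> powr (\<gamma> - \<beta> - 1)"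
          using S0 by linarith
      next
        assume \<tau>: "R n \<le> \<tau>"
        have "\<bar>?D\<bar> \<le> (\<Sum>i\<le>K. \<bar>c i * heat_semigroup (real i * \<tau>) f n\<bar>)"
          unfolding formula[OF less_imp_le[OF True]] by (rule sum_abs)
        also have "\<dots> = ?B + (\<Sum>i=1..K. \<bar>c i * heat_semigroup (real i * \<tau>) f n\<bar>)"
          unfolding atMost_atLeast0 by (subst sum.atLeast_Suc_atMost) (simp_all add: heat_semigroup_0[OF f] abs_mult)
        also have "\<dots> \<le> ?B + (\<Sum>i=1..K. \<bar>c i\<bar> * heat_semigroup (real i * \<tau>) (\<lambda>m. \<bar>f m\<bar>) n)"
          unfolding abs_mult using True by (intro add_left_mono sum_mono mult_left_mono heat_semigroup_abs_le f) auto
        finally have "\<bar>?D\<bar> / \<tau> powr (1 + \<beta>)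
            \<le> (?B + (\<Sum>i=1..K. \<bar>c i\<bar> * heat_semigroup (real i * \<tau>) (\<lambda>m. \<bar>f m\<bar>) n)) / \<tau> powr (1 + \<beta>)"
          by (intro divide_right_mono) auto
        also have "\<dots> = ?B / \<tau> powr (1 + \<beta>) + (\<Sum>i=1..K. \<bar>c i\<bar> * L i \<tau>)"
          using \<tau> by (simp add: add_divide_distrib L_def sum_divide_distrib)
        also have "?B / \<tau> powr (1 + \<beta>) = ?B * \<tau> powr (- \<beta> - 1)"
        proof -
          have "- \<beta> - 1 = - (1 + \<beta>)" by simp
          then show ?thesis by (simp only: powr_minus divide_inverse)
        qed
        finally show "\<bar>?D\<bar> / \<tau> powr (1 + \<beta>) - (\<Sum>i=1..K. \<bar>c i\<bar> * L i \<tau>) \<le> ?B * \<tau> powr (- \<beta> - 1)"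
          by linarith
      qed (use M in auto)
      then show ?thesis unfolding h_def \<psi> by linarith
    next
      case False
      have "0 \<le> h \<tau>" unfolding h_def
        using M by (intro add_nonneg_nonneg sum_nonneg mult_nonneg_nonneg L0 power_majorant_nonneg) auto
      with False show ?thesis by simp
    qed
    show ?thesis
      using integrable_dominated(1,2)[OF h meas bd] hC by linarith
  qed
  then show ?thesis using C unfolding R_def by blast
qed

text \<open>
  With \<open>e = \<alpha>/2 - k < \<beta>\<close>, the derivative of order \<open>k + K\<close> at time \<open>t + s\<close> is at most a multiple of
  \<open>(t + s) powr (e - K)\<close>, hence of \<open>t powr (e - \<delta>) * s powr (\<delta> - K)\<close> for every \<open>\<delta>\<close> between \<open>e\<close> and \<open>K\<close>.
  Choosing \<open>\<delta>\<close> above \<open>\<beta>\<close> for \<open>\<tau> \<le> t\<close> and below \<open>\<beta>\<close> for \<open>\<tau> \<ge> t\<close>, both parts of the time integral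
  are multiples of \<open>t powr (e - \<beta>)\<close>.
\<close>

theorem Lambda_H_frac_laplacian:
  assumes "\<beta> > 0" "2 * \<beta> < \<alpha>" "f \<in> Lambda_H \<alpha>" "f \<in> ell_space \<beta>"
  shows "frac_laplacian \<beta> f \<in> Lambda_H (\<alpha> - 2 * \<beta>)"
proof -
  define K where "K = nat \<lfloor>\<beta>\<rfloor> + 1"
  have integrand: "frac_integrand \<beta> f n \<tau> = (heat_difference \<tau> ^^ K) f n / \<tau> powr (1 + \<beta>)" for n \<tau>
    unfolding frac_integrand_def K_def ..
  have K: "\<beta> < real K" "K \<ge> 1" using assms(1) unfolding K_def by linarith+
  have \<alpha>: "\<alpha> > 0" "\<alpha> - 2 * \<beta> > 0" using assms by simp_all
  have f: "exp_growth f"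
    using assms(3) Lambda_H_iff[OF \<alpha>(1)] poly_growth_imp_exp_growth[OF _ \<alpha>(1)] by blast
  define \<Phi> where "\<Phi> = (\<lambda>n \<tau>. indicator {0<..} \<tau> * frac_integrand \<beta> f n \<tau>)"
  define F where "F = (\<lambda>n. integral\<^sup>L lborel (\<Phi> n))"
  define b where "b = (\<lambda>n. \<integral>\<tau>. \<bar>\<Phi> n \<tau>\<bar> \<partial>lborel)"
  obtain C where C: "C \<ge> 0" "\<And>n. integrable lborel (\<Phi> n)"
    "\<And>n. b n \<le> C * (1 + (real_of_int n)\<^sup>2) powr (\<alpha> / 2 - \<beta>)"
    using frac_integrand_local_bound[OF assms] unfolding \<Phi>_def b_def by blast
  have frac: "frac_laplacian \<beta> f = (\<lambda>n. 1 / frac_const \<beta> * F n)"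
    unfolding frac_laplacian_def [abs_def] F_def \<Phi>_def set_lebesgue_integral_def by simp
  have pgI: "poly_growth (\<alpha> - 2 * \<beta>) u"
    if "D \<ge> 0" "\<And>n. \<bar>u n\<bar> \<le> D * (1 + (real_of_int n)\<^sup>2) powr (\<alpha> / 2 - \<beta>)" for u D
  proof -
    have "poly_growth (2 * (\<alpha> / 2 - \<beta>)) u"
      by (rule poly_growthI_square[of D _ 1]) (use that assms(2) in auto)
    then show ?thesis by (simp add: algebra_simps)
  qed
  have b0: "b n \<ge> 0" for n unfolding b_def by simp
  have Fb: "\<bar>F n\<bar> \<le> b n" for n unfolding F_def b_def by (rule integral_abs_bound)
  have b: "exp_growth b"
    by (rule poly_growth_imp_exp_growth[OF pgI[OF C(1)] \<alpha>(2)]) (use C(3) b0 in auto)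
  have F: "exp_growth F" using b Fb b0 by (auto intro: exp_growth_le)
  have \<Phi>: "exp_growth (\<lambda>n. \<Phi> n \<tau>)" for \<tau>
  proof (cases "\<tau> > 0")
    case True
    have "exp_growth (\<lambda>n. (1 / \<tau> powr (1 + \<beta>)) * (heat_difference \<tau> ^^ K) f n)"
      using f True by (intro exp_growth_cmult exp_growth_heat_difference_pow) auto
    then show ?thesis using True by (simp add: \<Phi>_def integrand)
  qed (simp add: \<Phi>_def)
  define k where "k = heat_order (\<alpha> - 2 * \<beta>)"
  have k: "\<alpha> / 2 - \<beta> < real k" using heat_order_gt[of "\<alpha> - 2 * \<beta>"] by (simp add: k_def field_simps)
  have "\<alpha> / 2 < real (k + K)" using k K by simp
  from Lambda_H_heat_laplacian_bound[OF \<alpha>(1) assms(3) this]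
  obtain D where D: "D \<ge> 0" "\<And>t n. t > 0 \<Longrightarrow>
     \<bar>heat_semigroup t ((discrete_laplacian ^^ (k + K)) f) n\<bar> \<le> D * t powr (\<alpha> / 2 - real (k + K))" by blast
  define e where "e = \<alpha> / 2 - real k"
  (* The maximum keeps the exponent positive even if e is not. *)
  define \<delta>1 where "\<delta>1 = max e (\<beta> / 2)"
  define \<delta>2 where "\<delta>2 = (\<beta> + real K) / 2"
  have \<delta>1: "e \<le> \<delta>1" "0 < \<delta>1" "\<delta>1 < \<beta>" "\<delta>1 \<le> real K"
    using k K assms(1) by (auto simp: \<delta>1_def e_def)
  have \<delta>2: "e \<le> \<delta>2" "0 < \<delta>2" "\<beta> < \<delta>2" "\<delta>2 \<le> real K"
    using k K assms(1) by (auto simp: \<delta>2_def e_def)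
  let ?g = "(discrete_laplacian ^^ k) f"
  have g: "exp_growth ?g" using f by auto
  have step: "\<bar>(step_difference \<tau> ^^ K) (\<lambda>s. heat_semigroup s ?g n) t\<bar>
      \<le> D * t powr (e - \<delta>) * (real K / \<delta>) ^ K * \<tau> powr \<delta>"
    if \<delta>: "e \<le> \<delta>" "0 < \<delta>" "\<delta> \<le> real K" and t: "t > 0" and \<tau>: "\<tau> > 0" for \<delta> t \<tau> n
  proof (rule iterated_step_difference_bound[where w = "\<lambda>i s. heat_semigroup s ((discrete_laplacian ^^ i) ?g) n", simplified funpow_0])
    show "((\<lambda>s. heat_semigroup s ((discrete_laplacian ^^ i) ?g) n) has_real_derivative
        heat_semigroup s ((discrete_laplacian ^^ Suc i) ?g) n) (at s)" for i s
      using heat_equation[OF exp_growth_laplacian_pow[OF g]] by simp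
    fix s assume s: "0 < s" "s \<le> real K * \<tau>"
    have "(discrete_laplacian ^^ K) ?g = (discrete_laplacian ^^ (k + K)) f"
      by (simp add: funpow_add add.commute[of k])
    then have "\<bar>heat_semigroup (t + s) ((discrete_laplacian ^^ K) ?g) n\<bar> \<le> D * (t + s) powr (\<alpha> / 2 - real (k + K))"
      using D(2)[of "t + s" n] t s by simp
    also have "(t + s) powr (\<alpha> / 2 - real (k + K)) = (t + s) powr (e - \<delta>) * (t + s) powr (\<delta> - real K)"
      unfolding powr_add[symmetric] by (rule arg_cong[of _ _ "(powr) (t + s)"]) (simp add: e_def)
    also have "D * \<dots> \<le> D * (t powr (e - \<delta>) * s powr (\<delta> - real K))"
      using t s \<delta> D(1) by (intro mult_left_mono mult_mono powr_mono2') auto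
    finally show "\<bar>heat_semigroup (t + s) ((discrete_laplacian ^^ K) ?g) n\<bar> \<le> D * t powr (e - \<delta>) * s powr (\<delta> - real K)"
      by (simp add: mult.assoc)
  qed (use \<delta> \<tau> D in auto)
  define E where "E = D * (real K / \<delta>2) ^ K / (\<delta>2 - \<beta>) + D * (real K / \<delta>1) ^ K / (\<beta> - \<delta>1)"
  have main: "\<bar>heat_semigroup t ((discrete_laplacian ^^ k) F) n\<bar> \<le> E * t powr (e - \<beta>)" if t: "t > 0" for t n
  proof -
    define G where "G = (\<lambda>n \<tau>. heat_semigroup t (\<lambda>m. \<Phi> m \<tau>) n)"
    (* The heat flow passes under the time integral: the absolute integrals b have at most
       exponential growth, so they are summable against the kernel. *)
    have Gint: "integrable lborel (G n)" and FG: "heat_semigroup t F n = integral\<^sup>L lborel (G n)" for n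
    proof -
      let ?h = "\<lambda>m \<tau>. heat_kernel t (n - m) * \<Phi> m \<tau>"
      have 1: "integrable lborel (?h m)" for m using C(2) by simp
      have "(\<lambda>m. norm (heat_kernel t (n - m) * b m)) summable_on UNIV"
        by (rule iffD1[OF summable_on_iff_abs_summable_on_real has_sum_imp_summable[OF heat_kernel_has_sum[OF b]]])
      then have 2: "(\<lambda>m. \<integral>\<tau>. \<bar>?h m \<tau>\<bar> \<partial>lborel) summable_on UNIV"
        using b0 by (simp add: abs_mult b_def)
      have 3: "((\<lambda>m. ?h m \<tau>) has_sum G n \<tau>) UNIV" for \<tau>
        unfolding G_def by (rule heat_kernel_has_sum[OF \<Phi>])
      note I = integral_infsum_int[of ?h, OF 1 2 3]
      show "integrable lborel (G n)" by (rule I(1))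
      have "((\<lambda>m. heat_kernel t (n - m) * F m) has_sum integral\<^sup>L lborel (G n)) UNIV"
        using I(2) unfolding F_def by simp
      then show "heat_semigroup t F n = integral\<^sup>L lborel (G n)"
        using heat_kernel_has_sum[OF F] has_sum_unique by blast
    qed
    let ?\<psi> = "\<lambda>\<tau>. (discrete_laplacian ^^ k) (\<lambda>m. G m \<tau>) n"
    have "heat_semigroup t ((discrete_laplacian ^^ k) F) n = (discrete_laplacian ^^ k) (\<lambda>m. integral\<^sup>L lborel (G m)) n"
      unfolding heat_semigroup_laplacian_pow[OF F] using ext[of "heat_semigroup t F", OF FG] by simp
    also have "\<dots> = integral\<^sup>L lborel ?\<psi>" using laplacian_pow_integral[of G, OF Gint] by blast
    finally have eq: "heat_semigroup t ((discrete_laplacian ^^ k) F) n = integral\<^sup>L lborel ?\<psi>" .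
    have \<psi>int: "integrable lborel ?\<psi>" using laplacian_pow_integral[of G, OF Gint] by blast
    have \<psi>pos: "?\<psi> \<tau> = 1 / \<tau> powr (1 + \<beta>) * (step_difference \<tau> ^^ K) (\<lambda>s. heat_semigroup s ?g n) t"
      if \<tau>: "\<tau> > 0" for \<tau>
    proof -
      have \<tau>0: "\<tau> \<ge> 0" using \<tau> by simp
      let ?d = "(heat_difference \<tau> ^^ K) f"
      have d: "exp_growth ?d" using f \<tau>0 by auto
      have "G m \<tau> = 1 / \<tau> powr (1 + \<beta>) * heat_semigroup t ?d m" for m
      proof -
        have "(\<lambda>m. \<Phi> m \<tau>) = (\<lambda>m. 1 / \<tau> powr (1 + \<beta>) * ?d m)"
          using \<tau> by (simp add: \<Phi>_def integrand)
        then show ?thesis unfolding G_def by (simp only: heat_semigroup_cmult[OF d])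
      qed
      then have "?\<psi> \<tau> = 1 / \<tau> powr (1 + \<beta>) * (discrete_laplacian ^^ k) (heat_semigroup t ?d) n"
        using laplacian_pow_cmult[of k "1 / \<tau> powr (1 + \<beta>)" "heat_semigroup t ?d" n] by simp
      also have "(discrete_laplacian ^^ k) (heat_semigroup t ?d) n = heat_semigroup t ((heat_difference \<tau> ^^ K) ?g) n"
        using heat_semigroup_laplacian_pow[OF d, of t k] heat_difference_pow_laplacian_pow[OF f \<tau>0, of K k] by simp
      also have "\<dots> = (step_difference \<tau> ^^ K) (\<lambda>s. heat_semigroup s ?g n) t"
        by (rule heat_semigroup_heat_difference_pow[OF g \<tau>0]) (use t in simp)
      finally show ?thesis .
    qed
    let ?A = "D * t powr (e - \<delta>2) * (real K / \<delta>2) ^ K" and ?B = "D * t powr (e - \<delta>1) * (real K / \<delta>1) ^ K"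
    let ?P = "power_majorant ?A (\<delta>2 - \<beta>) ?B (\<beta> - \<delta>1) t"
    have A0: "?A \<ge> 0" "?B \<ge> 0" using D(1) \<delta>1 \<delta>2 by auto
    have bd: "\<bar>?\<psi> \<tau>\<bar> \<le> ?P \<tau>" for \<tau>
    proof (cases "\<tau> > 0")
      case True
      have st: "\<bar>?\<psi> \<tau>\<bar> \<le> D * t powr (e - \<delta>) * (real K / \<delta>) ^ K * \<tau> powr (\<delta> - \<beta> - 1)"
        if \<delta>: "e \<le> \<delta>" "0 < \<delta>" "\<delta> \<le> real K" for \<delta>
      proof -
        have "\<bar>?\<psi> \<tau>\<bar> = \<bar>(step_difference \<tau> ^^ K) (\<lambda>s. heat_semigroup s ?g n) t\<bar> / \<tau> powr (1 + \<beta>)"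
          unfolding \<psi>pos[OF True] by (simp add: abs_mult)
        also have "\<dots> \<le> D * t powr (e - \<delta>) * (real K / \<delta>) ^ K * \<tau> powr \<delta> / \<tau> powr (1 + \<beta>)"
          using step[OF \<delta> t True] by (intro divide_right_mono) auto
        also have "\<dots> = D * t powr (e - \<delta>) * (real K / \<delta>) ^ K * \<tau> powr (\<delta> - \<beta> - 1)"
          by (simp flip: powr_divide_powr)
        finally show ?thesis .
      qed
      show ?thesis
        by (rule abs_le_power_majorant[OF A0 _ _ True])
          (use st[OF \<delta>1(1,2,4)] st[OF \<delta>2(1,2,4)] in \<open>simp_all add: algebra_simps\<close>)
    next
      case False
      then have "\<Phi> m \<tau> = 0" for m by (simp add: \<Phi>_def)
      then have "G m \<tau> = 0" for m unfolding G_def by (simp add: heat_semigroup_const)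
      then have "?\<psi> \<tau> = 0" using laplacian_pow_cmult[of k 0 "\<lambda>_. 0" n] by simp
      then show ?thesis using power_majorant_nonneg[OF A0] by simp
    qed
    have meas: "?\<psi> \<in> borel_measurable borel" using borel_measurable_integrable[OF \<psi>int] by simp
    have P: "integrable lborel ?P"
      "integral\<^sup>L lborel ?P = ?A * (t powr (\<delta>2 - \<beta>) / (\<delta>2 - \<beta>)) + ?B * (t powr (- (\<beta> - \<delta>1)) / (\<beta> - \<delta>1))"
      using power_majorant_integral[of "\<delta>2 - \<beta>" "\<beta> - \<delta>1" t] \<delta>1 \<delta>2 t by auto
    have "\<bar>integral\<^sup>L lborel ?\<psi>\<bar> \<le> integral\<^sup>L lborel ?P"
      by (rule integrable_dominated(3)[OF P(1) meas bd])
    also have "\<dots> = E * t powr (e - \<beta>)"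
    proof -
      have pw: "t powr (e - \<delta>2) * t powr (\<delta>2 - \<beta>) = t powr (e - \<beta>)"
        "t powr (e - \<delta>1) * t powr (- (\<beta> - \<delta>1)) = t powr (e - \<beta>)" by (simp_all flip: powr_add)
      have rearrange: "a * x * c * (y / d) = a * c / d * (x * y)" for a x c y d :: real by simp
      show ?thesis unfolding P(2) E_def distrib_right rearrange pw ..
    qed
    finally show ?thesis unfolding eq .
  qed
  have E: "E \<ge> 0" unfolding E_def using D \<delta>1 \<delta>2 by (intro add_nonneg_nonneg divide_nonneg_nonneg mult_nonneg_nonneg) auto
  let ?c = "1 / frac_const \<beta>"
  have heat: "\<bar>heat_semigroup t ((discrete_laplacian ^^ k) (frac_laplacian \<beta> f)) n\<bar>
      \<le> (\<bar>?c\<bar> * E) * t powr ((\<alpha> - 2 * \<beta>) / 2 - real k)" if "t > 0" for t n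
  proof -
    have "(discrete_laplacian ^^ k) (frac_laplacian \<beta> f) = (\<lambda>n. ?c * (discrete_laplacian ^^ k) F n)"
      unfolding frac by (rule ext) (rule laplacian_pow_cmult)
    then have "\<bar>heat_semigroup t ((discrete_laplacian ^^ k) (frac_laplacian \<beta> f)) n\<bar>
        = \<bar>?c\<bar> * \<bar>heat_semigroup t ((discrete_laplacian ^^ k) F) n\<bar>"
      using heat_semigroup_cmult[OF exp_growth_laplacian_pow[OF F], of t ?c k n] by (simp only: abs_mult)
    also have "\<dots> \<le> \<bar>?c\<bar> * (E * t powr (e - \<beta>))" by (intro mult_left_mono main that) auto
    also have "e - \<beta> = (\<alpha> - 2 * \<beta>) / 2 - real k" by (simp add: e_def field_simps)
    finally show ?thesis by (simp only: mult.assoc)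
  qed
  have "poly_growth (\<alpha> - 2 * \<beta>) (frac_laplacian \<beta> f)"
  proof (rule pgI)
    show "\<bar>frac_laplacian \<beta> f n\<bar> \<le> (\<bar>?c\<bar> * C) * (1 + (real_of_int n)\<^sup>2) powr (\<alpha> / 2 - \<beta>)" for n
      using mult_left_mono[OF order_trans[OF Fb C(3)], of "\<bar>?c\<bar>" n] unfolding frac abs_mult by (simp add: mult.assoc)
  qed (use C(1) in auto)
  then show ?thesis
    unfolding Lambda_H_iff[OF \<alpha>(2)] k_def[symmetric]
    using heat E by (intro conjI exI[of _ "\<bar>?c\<bar> * E"]) auto
qed

theorem theorem4:
  fixes \<alpha> \<beta> :: real and f :: "int \<Rightarrow> real"
  assumes "\<alpha> > 0" and "\<beta> > 0" and "0 < 2 * \<beta>" and "2 * \<beta> < \<alpha>"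
  shows "(f \<in> Lambda_H \<alpha> \<inter> ell_space \<beta> \<longrightarrow>
            (\<forall>n. set_integrable lborel {0<..} (frac_integrand \<beta> f n)) \<and>
            frac_laplacian \<beta> f \<in> Lambda_H (\<alpha> - 2 * \<beta>)) \<and>
         (\<forall>m::nat. f \<in> Lambda_H \<alpha> \<and> \<beta> = real m \<longrightarrow>
            ((\<lambda>g n. - discrete_laplacian g n) ^^ m) f \<in> Lambda_H (\<alpha> - 2 * \<beta>))"
proof (intro conjI impI allI)
  fix n assume "f \<in> Lambda_H \<alpha> \<inter> ell_space \<beta>"
  then show "set_integrable lborel {0<..} (frac_integrand \<beta> f n)"
    using frac_integrand_local_bound[OF assms(2,4), of f] unfolding set_integrable_def by auto
next
  assume "f \<in> Lambda_H \<alpha> \<inter> ell_space \<beta>"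
  then show "frac_laplacian \<beta> f \<in> Lambda_H (\<alpha> - 2 * \<beta>)"
    using Lambda_H_frac_laplacian[OF assms(2,4)] by blast
next
  fix m assume "f \<in> Lambda_H \<alpha> \<and> \<beta> = real m"
  then show "((\<lambda>g n. - discrete_laplacian g n) ^^ m) f \<in> Lambda_H (\<alpha> - 2 * \<beta>)"
    using Lambda_H_iterated_laplacian[OF assms(1), of f m] assms(4) by simp
qed

end
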